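(* Let $G=(V,E)$ be a connected, finitely represented infinite graph of finite maximum degree $\Delta$ that satisfies the expansion property and the polynomial growth property. Then Infinite Windy Firebreak Location is solvable in polynomial time on the class $\mathcal G_G$ of instances of the form $(G[V\setminus V'],\widetilde V,B)$, where $V'\subset V$ is finite and $\Delta$, $|V'|$, $|\widetilde V|$ and $B$ are bounded by the size $n$ of the instance.
   Context: Infinite Windy Firebreak Location: an instance is $(G,\widetilde V,B)$ with $G$ an undirected infinite graph described by a finite string of length at most $n$ (the size), $\widetilde V$ a finite set of initially burning vertices with $|\widetilde V|\le n$, and an integer budget $B\le n$. The question is whether there is an edge set $H$ with $|H|\le B$ such that every vertex of $\widetilde V$ lies in a finite connected component of the graph obtained by deleting $H$. Distances are shortest-path distances; the ball of center $x$ and radius $K$ is $\{y:d(x,y)\le K\}$. Polynomial growth property: there is a polynomial $P$ such that every ball of radius $K$ has at most $P(K)$ vertices. For $U\subset V$, an escaping edge from $G[U]$ is an edge between $U$ and a vertex of an infinite connected component of $G[V\setminus U]$. Expansion property: there is an integer-valued polynomial function $L$ such that, for every integer $B$, every finite subgraph with more than $L(B)$ vertices has at least $B+1$ escaping edges.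
   Formalization: "Finitely represented" is made precise: a fixed program lists the neighbours of a vertex in time polynomial in its name's length, and name lengths are polynomially bounded in the length of another vertex's name plus the distance; a bare finite description would not suffice. *)

theory Defs
  imports "HOL-Computational_Algebra.Polynomial"
begin

section \<open>Possibly infinite simple undirected graphs\<close>

type_synonym 'v ugraph = "'v set \<times> 'v set set"

abbreviation verts :: "'v ugraph \<Rightarrow> 'v set" where
  "verts G \<equiv> fst G"

abbreviation edges :: "'v ugraph \<Rightarrow> 'v set set" where
  "edges G \<equiv> snd G"

definition simple_graph :: "'v ugraph \<Rightarrow> bool" where
  "simple_graph G \<longleftrightarrow> (\<forall>e\<in>edges G. e \<subseteq> verts G \<and> card e = 2)"

definition adjacent :: "'v ugraph \<Rightarrow> 'v \<Rightarrow> 'v \<Rightarrow> bool" where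
  "adjacent G u v \<longleftrightarrow> {u, v} \<in> edges G"

definition neighbours :: "'v ugraph \<Rightarrow> 'v \<Rightarrow> 'v set" where
  "neighbours G v = {w. adjacent G v w}"

definition induced :: "'v ugraph \<Rightarrow> 'v set \<Rightarrow> 'v ugraph" where
  "induced G U = (verts G \<inter> U, {e \<in> edges G. e \<subseteq> U})"

definition delete_edges :: "'v ugraph \<Rightarrow> 'v set set \<Rightarrow> 'v ugraph" where
  "delete_edges G H = (verts G, edges G - H)"

definition component_of :: "'v ugraph \<Rightarrow> 'v \<Rightarrow> 'v set" where
  "component_of G v = {w \<in> verts G. (adjacent G)\<^sup>*\<^sup>* v w}"

definition connected_graph :: "'v ugraph \<Rightarrow> bool" where
  "connected_graph G \<longleftrightarrow>
     verts G \<noteq> {} \<and> (\<forall>u\<in>verts G. \<forall>v\<in>verts G. (adjacent G)\<^sup>*\<^sup>* u v)"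

text \<open>The maximum is required to be attained, so \<open>\<Delta>\<close> is determined by \<open>G\<close>.\<close>

definition has_max_degree :: "'v ugraph \<Rightarrow> nat \<Rightarrow> bool" where
  "has_max_degree G \<Delta> \<longleftrightarrow>
     (\<forall>v\<in>verts G. finite (neighbours G v) \<and> card (neighbours G v) \<le> \<Delta>) \<and>
     (\<exists>v\<in>verts G. card (neighbours G v) = \<Delta>)"

text \<open>The value is meaningful only if \<open>v\<close> is reachable from \<open>u\<close>.\<close>

definition graph_dist :: "'v ugraph \<Rightarrow> 'v \<Rightarrow> 'v \<Rightarrow> nat" where
  "graph_dist G u v = (LEAST k. (adjacent G ^^ k) u v)"

definition graph_ball :: "'v ugraph \<Rightarrow> 'v \<Rightarrow> nat \<Rightarrow> 'v set" where
  "graph_ball G x K = {y \<in> component_of G x. graph_dist G x y \<le> K}"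

definition polynomial_growth :: "'v ugraph \<Rightarrow> bool" where
  "polynomial_growth G \<longleftrightarrow>
     (\<exists>P :: real poly. \<forall>x\<in>verts G. \<forall>K.
        finite (graph_ball G x K) \<and> real (card (graph_ball G x K)) \<le> poly P (real K))"

definition escaping_edges :: "'v ugraph \<Rightarrow> 'v set \<Rightarrow> 'v set set" where
  "escaping_edges G U =
     {e \<in> edges G. \<exists>u w. e = {u, w} \<and> u \<in> U \<and> w \<in> verts G - U \<and>
        infinite (component_of (induced G (verts G - U)) w)}"

text \<open>Integer-valued polynomials may have non-integer coefficients,
  for example \<open>B * (B + 1) / 2\<close>. The set of escaping edges is finite for the
  graphs of bounded degree considered below, so \<open>card\<close> is the true cardinality.\<close>

definition expansion_property :: "'v ugraph \<Rightarrow> bool" where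
  "expansion_property G \<longleftrightarrow>
     (\<exists>L :: real poly. (\<forall>k :: int. poly L (of_int k) \<in> \<int>) \<and>
        (\<forall>(B :: int) U. U \<subseteq> verts G \<longrightarrow> finite U \<longrightarrow> real (card U) > poly L (of_int B) \<longrightarrow>
           int (card (escaping_edges G U)) \<ge> B + 1))"


section \<open>Infinite Windy Firebreak Location\<close>

type_synonym 'v firebreak_instance = "'v ugraph \<times> 'v set \<times> nat"

definition firebreak_yes :: "'v firebreak_instance \<Rightarrow> bool" where
  "firebreak_yes = (\<lambda>(G, V\<^sub>0, B).
     \<exists>H \<subseteq> edges G. finite H \<and> card H \<le> B \<and>
        (\<forall>v\<in>V\<^sub>0. finite (component_of (delete_edges G H) v)))"


section \<open>Polynomial time\<close>

text \<open>The machine model is the WHILE language over binary trees of N. D. Jones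
  (Computability and Complexity from a Programming Perspective, MIT Press 1997).
  Evaluating an expression is charged the sizes of the values of all its
  subexpressions, not unit cost. Hence values of super-polynomial size cannot be built
  by sharing in polynomial time, a Turing machine that writes all trees out in full
  simulates a run with polynomial overhead, and, conversely, programs simulate Turing
  machines with polynomial overhead: polynomial time has its usual meaning.\<close>

datatype data = Leaf | Node data data

primrec dsize :: "data \<Rightarrow> nat" where
  "dsize Leaf = 1"
| "dsize (Node a b) = Suc (dsize a + dsize b)"

primrec head :: "data \<Rightarrow> data" where
  "head Leaf = Leaf"
| "head (Node a b) = a"

primrec tail :: "data \<Rightarrow> data" where
  "tail Leaf = Leaf"
| "tail (Node a b) = b"

primrec bool_data :: "bool \<Rightarrow> data" where
  "bool_data False = Leaf"
| "bool_data True = Node Leaf Leaf"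

primrec list_data :: "data list \<Rightarrow> data" where
  "list_data [] = Leaf"
| "list_data (x # xs) = Node x (list_data xs)"

text \<open>Natural numbers are written in unary.\<close>

definition nat_data :: "nat \<Rightarrow> data" where
  "nat_data n = list_data (replicate n Leaf)"

datatype expr =
    Var nat
  | LeafE
  | NodeE expr expr
  | HeadE expr
  | TailE expr
  | EqE expr expr

datatype com =
    Skip
  | Assign nat expr
  | Seq com com
  | Cond expr com com
  | While expr com

type_synonym state = "nat \<Rightarrow> data"

primrec eval :: "expr \<Rightarrow> state \<Rightarrow> data" where
  "eval (Var x) s = s x"
| "eval LeafE s = Leaf"
| "eval (NodeE e f) s = Node (eval e s) (eval f s)"
| "eval (HeadE e) s = head (eval e s)"
| "eval (TailE e) s = tail (eval e s)"
| "eval (EqE e f) s = bool_data (eval e s = eval f s)"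

primrec cost :: "expr \<Rightarrow> state \<Rightarrow> nat" where
  "cost (Var x) s = dsize (s x)"
| "cost LeafE s = 1"
| "cost (NodeE e f) s = cost e s + cost f s + dsize (eval (NodeE e f) s)"
| "cost (HeadE e) s = cost e s + dsize (eval (HeadE e) s)"
| "cost (TailE e) s = cost e s + dsize (eval (TailE e) s)"
| "cost (EqE e f) s = cost e s + cost f s + dsize (eval (EqE e f) s)"

text \<open>\<open>exec c s t s'\<close>: started in state \<open>s\<close>, the program \<open>c\<close> terminates in state
  \<open>s'\<close> after time \<open>t\<close>. \<open>Leaf\<close> is the only false value.\<close>

inductive exec :: "com \<Rightarrow> state \<Rightarrow> nat \<Rightarrow> state \<Rightarrow> bool" where
  Skip: "exec Skip s 1 s"
| Assign: "exec (Assign x e) s (1 + cost e s) (s(x := eval e s))"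
| Seq: "exec c s t s' \<Longrightarrow> exec d s' t' s'' \<Longrightarrow> exec (Seq c d) s (t + t') s''"
| CondTrue: "eval e s \<noteq> Leaf \<Longrightarrow> exec c s t s' \<Longrightarrow>
    exec (Cond e c d) s (1 + cost e s + t) s'"
| CondFalse: "eval e s = Leaf \<Longrightarrow> exec d s t s' \<Longrightarrow>
    exec (Cond e c d) s (1 + cost e s + t) s'"
| WhileFalse: "eval e s = Leaf \<Longrightarrow> exec (While e c) s (1 + cost e s) s"
| WhileTrue: "eval e s \<noteq> Leaf \<Longrightarrow> exec c s t s' \<Longrightarrow> exec (While e c) s' t' s'' \<Longrightarrow>
    exec (While e c) s (1 + cost e s + t + t') s''"

text \<open>Input and output are passed in variable \<open>0\<close>; all other variables start as \<open>Leaf\<close>.\<close>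

definition computes_within :: "com \<Rightarrow> data \<Rightarrow> data \<Rightarrow> nat \<Rightarrow> bool" where
  "computes_within c x y T \<longleftrightarrow>
     (\<exists>t s. exec c ((\<lambda>_. Leaf)(0 := x)) t s \<and> s 0 = y \<and> t \<le> T)"

text \<open>A class of instances is a set of pairs of an encoding and the instance that it
  encodes. The encoding is promised to come from the class.\<close>

definition poly_time_solvable :: "(data \<times> 'i) set \<Rightarrow> ('i \<Rightarrow> bool) \<Rightarrow> bool" where
  "poly_time_solvable C Q \<longleftrightarrow>
     (\<exists>c (p :: nat poly). \<forall>(x, i)\<in>C. computes_within c x (bool_data (Q i)) (poly p (dsize x)))"


section \<open>Finitely represented graphs and their instances\<close>

text \<open>Vertices are named by data, and the graph is described by a program that lists,
  in polynomial time, the names of the neighbours of a vertex. The last clause says that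
  names at distance \<open>k\<close> from \<open>u\<close> have length polynomial in \<open>k\<close> and the length of the name
  of \<open>u\<close>. It does not follow from the other clauses (neighbouring names may
  double in length at each step), and without it even a ball with few vertices
  could not be written down in polynomial time.\<close>

definition finitely_represented :: "'v ugraph \<Rightarrow> ('v \<Rightarrow> data) \<Rightarrow> com \<Rightarrow> bool" where
  "finitely_represented G name nb \<longleftrightarrow>
     inj_on name (verts G) \<and>
     (\<exists>p :: nat poly. \<forall>v\<in>verts G. \<exists>ws. set ws = neighbours G v \<and>
        computes_within nb (name v) (list_data (map name ws)) (poly p (dsize (name v)))) \<and>
     (\<exists>q :: nat poly. \<forall>u\<in>verts G. \<forall>v\<in>verts G.
        dsize (name v) \<le> poly q (dsize (name u) + graph_dist G u v))"

text \<open>The program text as data: this is the finite string that describes the graph.\<close>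

primrec expr_data :: "expr \<Rightarrow> data" where
  "expr_data (Var x) = list_data [nat_data 0, nat_data x]"
| "expr_data LeafE = list_data [nat_data 1]"
| "expr_data (NodeE e f) = list_data [nat_data 2, expr_data e, expr_data f]"
| "expr_data (HeadE e) = list_data [nat_data 3, expr_data e]"
| "expr_data (TailE e) = list_data [nat_data 4, expr_data e]"
| "expr_data (EqE e f) = list_data [nat_data 5, expr_data e, expr_data f]"

primrec com_data :: "com \<Rightarrow> data" where
  "com_data Skip = list_data [nat_data 0]"
| "com_data (Assign x e) = list_data [nat_data 1, nat_data x, expr_data e]"
| "com_data (Seq c d) = list_data [nat_data 2, com_data c, com_data d]"
| "com_data (Cond e c d) = list_data [nat_data 3, expr_data e, com_data c, com_data d]"
| "com_data (While e c) = list_data [nat_data 4, expr_data e, com_data c]"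

text \<open>The instance \<open>(G[V - V'], V\<^sub>0, B)\<close> is encoded by the description of \<open>G\<close>, lists of the
  names of \<open>V'\<close> and of \<open>V\<^sub>0\<close> in arbitrary order, and \<open>B\<close>. Its size is the size of this
  encoding; \<open>B\<close> may be written in unary because it is bounded by the size.\<close>

definition firebreak_class ::
  "'v ugraph \<Rightarrow> nat \<Rightarrow> ('v \<Rightarrow> data) \<Rightarrow> com \<Rightarrow> (data \<times> 'v firebreak_instance) set" where
  "firebreak_class G \<Delta> name nb =
     {(x, (induced G (verts G - V'), V\<^sub>0, B)) | x V' V\<^sub>0 B.
        finite V' \<and> V' \<subseteq> verts G \<and> finite V\<^sub>0 \<and> V\<^sub>0 \<subseteq> verts G - V' \<and>
        (\<exists>xs ys. distinct xs \<and> set xs = V' \<and> distinct ys \<and> set ys = V\<^sub>0 \<and>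
           x = list_data [com_data nb, list_data (map name xs), list_data (map name ys),
                 nat_data B]) \<and>
        \<Delta> \<le> dsize x \<and> card V' \<le> dsize x \<and> card V\<^sub>0 \<le> dsize x \<and> B \<le> dsize x}"

end

theory Submission
  imports Defs
begin

text \<open>Let \<open>U\<close> be the set of vertices that burn behind a firebreak of at most \<open>B\<close> edges. Edges
  escaping from \<open>U\<close> in \<open>G\<close> lie in the firebreak or meet \<open>V'\<close>, so there are at most
  \<open>B + \<Delta> * card V'\<close> of them, and the expansion property bounds \<open>card U\<close> by a polynomial.
  Hence \<open>U\<close> stays within a polynomial radius of the burning vertices, and by polynomial
  growth the region \<open>X\<close> of that radius has polynomial size. The instance is positive iff at
  most \<open>B\<close> edges separate the burning vertices from the complement of \<open>X\<close>. This is decided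
  by searching for more than \<open>B\<close> augmenting paths in \<open>X\<close>.

  Running times are not computed explicitly: the functions computed in polynomial time by
  WHILE programs are closed under composition, pairing, conditionals and iteration along
  lists with polynomially bounded accumulators, and the algorithm is written with these.\<close>

section \<open>Polynomial bounds\<close>

text \<open>Two obstacles shape the proof. The neighbour program is guaranteed to halt, and to halt
  in time, only on names of vertices; hence polynomial time is always relative to a domain, and each
  iteration carries an invariant that keeps its arguments in that domain. Moreover, iterating a
  polynomial-time map need not take polynomial time, because values may double in size at every
  step; each iteration therefore needs an a priori bound on all intermediate values. For the region
  \<open>X\<close> this bound combines polynomial growth (few names) with the clause on name lengths
  (short names). Inside \<open>X\<close> the problem is a minimum cut problem with unit capacities,
  where every vertex outside \<open>X\<close> acts as a sink. Only \<open>B\<close> rounds of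
  augmentation are run: a path that remains after them yields a flow of value \<open>B + 1\<close>,
  which excludes all cuts with at most \<open>B\<close> arcs. The neighbour program belongs to the
  class, not to the single instance, so it is built into the algorithm as a subroutine.\<close>

definition poly_bounded :: "(nat \<Rightarrow> nat) \<Rightarrow> bool" where
  "poly_bounded b \<longleftrightarrow> (\<exists>p :: nat poly. \<forall>n. b n \<le> poly p n)"

lemma poly_nat_mono: "m \<le> n \<Longrightarrow> poly p m \<le> poly p n" for p :: "nat poly"
  by (induction p) (auto intro: add_mono mult_mono)

lemma poly_bounded_const: "poly_bounded (\<lambda>_. k)"
  unfolding poly_bounded_def by (rule exI[of _ "[:k:]"]) simp

lemma poly_bounded_id: "poly_bounded (\<lambda>n. n)"
  unfolding poly_bounded_def by (rule exI[of _ "[:0, 1:]"]) simp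

lemma poly_bounded_add:
  assumes "poly_bounded a" "poly_bounded b"
  shows "poly_bounded (\<lambda>n. a n + b n)"
proof -
  obtain p q :: "nat poly" where "\<And>n. a n \<le> poly p n" "\<And>n. b n \<le> poly q n"
    using assms unfolding poly_bounded_def by blast
  then show ?thesis
    unfolding poly_bounded_def by (intro exI[of _ "p + q"]) (simp add: add_mono)
qed

lemma poly_bounded_mult:
  assumes "poly_bounded a" "poly_bounded b"
  shows "poly_bounded (\<lambda>n. a n * b n)"
proof -
  obtain p q :: "nat poly" where "\<And>n. a n \<le> poly p n" "\<And>n. b n \<le> poly q n"
    using assms unfolding poly_bounded_def by blast
  then show ?thesis
    unfolding poly_bounded_def by (intro exI[of _ "p * q"]) (simp add: mult_mono)
qed

lemma poly_bounded_Suc: "poly_bounded a \<Longrightarrow> poly_bounded (\<lambda>n. Suc (a n))"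
  using poly_bounded_add[OF _ poly_bounded_const[of 1]] by simp

lemma poly_bounded_poly:
  assumes "poly_bounded b"
  shows "poly_bounded (\<lambda>n. poly p (b n))"
proof -
  obtain q :: "nat poly" where "\<And>n. b n \<le> poly q n"
    using assms unfolding poly_bounded_def by blast
  then show ?thesis
    unfolding poly_bounded_def
    by (intro exI[of _ "pcompose p q"]) (simp add: poly_pcompose poly_nat_mono)
qed

lemmas poly_bounded_intros =
  poly_bounded_const poly_bounded_id poly_bounded_add poly_bounded_mult poly_bounded_Suc
  poly_bounded_poly

text \<open>Horner evaluation at \<open>k \<ge> 0\<close> is monotone in the coefficients, so each
  coefficient \<open>a\<close> may be replaced by \<open>nat \<lceil>a\<rceil>\<close>. This turns
  the real polynomials of the growth and expansion properties into monotone bounds.\<close>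

lemma real_poly_le_nat_poly:
  fixes P :: "real poly"
  shows "\<exists>q :: nat poly. \<forall>k. poly P (real k) \<le> real (poly q k)"
proof (induction P)
  case 0
  show ?case by (rule exI[of _ 0]) simp
next
  case (pCons a P)
  then obtain q :: "nat poly" where q: "\<And>k. poly P (real k) \<le> real (poly q k)" by blast
  have "poly (pCons a P) (real k) \<le> real (poly (pCons (nat \<lceil>a\<rceil>) q) k)" for k
    using mult_left_mono[OF q[of k], of "real k"] real_nat_ceiling_ge[of a] by simp
  then show ?case by blast
qed


section \<open>Programs with time bounds\<close>

text \<open>An upper bound instead of the exact time of \<open>exec\<close>, so that estimates can
  be weakened and added along a program.\<close>

definition runs :: "com \<Rightarrow> state \<Rightarrow> nat \<Rightarrow> state \<Rightarrow> bool" where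
  "runs c s T s' \<longleftrightarrow> (\<exists>t\<le>T. exec c s t s')"

lemma runs_mono: "runs c s T s' \<Longrightarrow> T \<le> T' \<Longrightarrow> runs c s T' s'"
  unfolding runs_def by (meson le_trans)

lemma runs_Assign: "s' = s(x := eval e s) \<Longrightarrow> runs (Assign x e) s (1 + cost e s) s'"
  unfolding runs_def by (metis exec.Assign order_refl)

lemma runs_Seq: "runs c s T s' \<Longrightarrow> runs d s' T' s'' \<Longrightarrow> runs (Seq c d) s (T + T') s''"
  unfolding runs_def by (meson exec.Seq add_mono)

lemma runs_Cond:
  assumes "runs (if eval e s \<noteq> Leaf then c else d) s T s'"
  shows "runs (Cond e c d) s (1 + cost e s + T) s'"
proof -
  obtain t where t: "t \<le> T" "exec (if eval e s \<noteq> Leaf then c else d) s t s'"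
    using assms unfolding runs_def by blast
  have "exec (Cond e c d) s (1 + cost e s + t) s'"
    using t(2) by (cases "eval e s = Leaf") (simp_all only: if_True if_False not_True_eq_False
      simp_thms exec.CondTrue exec.CondFalse)
  then show ?thesis unfolding runs_def using t(1) by (meson add_left_mono)
qed

lemma runs_While_Leaf: "eval e s = Leaf \<Longrightarrow> runs (While e c) s (1 + cost e s) s"
  unfolding runs_def by (metis exec.WhileFalse order_refl)

lemma runs_While:
  assumes "eval e s \<noteq> Leaf" "runs c s T s'" "runs (While e c) s' T' s''"
  shows "runs (While e c) s (1 + cost e s + T + T') s''"
proof -
  obtain t t' where "t \<le> T" "exec c s t s'" "t' \<le> T'" "exec (While e c) s' t' s''"
    using assms unfolding runs_def by blast
  then have "exec (While e c) s (1 + cost e s + t + t') s''"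
    using assms(1) by (intro exec.WhileTrue)
  then show ?thesis
    unfolding runs_def using \<open>t \<le> T\<close> \<open>t' \<le> T'\<close> by (meson add_mono order_refl)
qed

lemma dsize_le_cost: "dsize (eval e s) \<le> cost e s"
  by (induction e) auto

text \<open>The cost of an expression is at least the size of its value, so no variable can grow by
  more than the time spent. Every time bound thus doubles as a size bound on results.\<close>

lemma exec_dsize: "exec c s t s' \<Longrightarrow> dsize (s' y) \<le> dsize (s y) + t"
proof (induction rule: exec.induct)
  case (Assign x e s)
  then show ?case using dsize_le_cost[of e s] by auto
qed auto

lemma runs_dsize: "runs c s T s' \<Longrightarrow> dsize (s' y) \<le> dsize (s y) + T"
  unfolding runs_def using exec_dsize by (meson add_left_mono le_trans)

text \<open>The program works from arbitrary contents of the auxiliary variables, and keeps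
  those from \<open>m\<close> on, so that programs can be composed without renaming.\<close>

definition ptime :: "data set \<Rightarrow> (data \<Rightarrow> data) \<Rightarrow> bool" where
  "ptime D f \<longleftrightarrow> (\<exists>c m (p :: nat poly). \<forall>s. s 0 \<in> D \<longrightarrow>
     (\<exists>s'. runs c s (poly p (dsize (s 0))) s' \<and> s' 0 = f (s 0) \<and> (\<forall>y\<ge>m. s' y = s y)))"

lemma ptimeI:
  assumes "poly_bounded b"
    and "\<And>s. s 0 \<in> D \<Longrightarrow> \<exists>s'. runs c s (b (dsize (s 0))) s' \<and> s' 0 = f (s 0) \<and> (\<forall>y\<ge>m. s' y = s y)"
  shows "ptime D f"
proof -
  obtain p :: "nat poly" where "\<And>n. b n \<le> poly p n"
    using assms(1) unfolding poly_bounded_def by blast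
  then show ?thesis
    unfolding ptime_def using assms(2) runs_mono by (intro exI[of _ c] exI[of _ m] exI[of _ p]) blast
qed

lemma ptimeE:
  assumes "ptime D f"
  obtains c M and p :: "nat poly"
  where "0 < M" "\<And>s. s 0 \<in> D \<Longrightarrow>
    \<exists>s'. runs c s (poly p (dsize (s 0))) s' \<and> s' 0 = f (s 0) \<and> (\<forall>y\<ge>M. s' y = s y)"
proof -
  obtain c m and p :: "nat poly" where *: "\<And>s. s 0 \<in> D \<Longrightarrow>
    \<exists>s'. runs c s (poly p (dsize (s 0))) s' \<and> s' 0 = f (s 0) \<and> (\<forall>y\<ge>m. s' y = s y)"
    using assms unfolding ptime_def by blast
  \<comment> \<open>Passing to \<open>Suc m\<close> makes the bound positive: registers from there
    on are distinct from variable \<open>0\<close>, which carries input and output.\<close>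
  show thesis
    by (rule that[of "Suc m" c p]) (use * in \<open>auto, meson Suc_leD\<close>)
qed

lemma ptime_dsize:
  assumes "ptime D f"
  obtains p :: "nat poly" where "\<And>x. x \<in> D \<Longrightarrow> dsize (f x) \<le> poly p (dsize x)"
proof -
  obtain c M and p :: "nat poly" where *: "\<And>s. s 0 \<in> D \<Longrightarrow>
    \<exists>s'. runs c s (poly p (dsize (s 0))) s' \<and> s' 0 = f (s 0) \<and> (\<forall>y\<ge>M. s' y = s y)"
    using ptimeE[OF assms] by metis
  have "dsize (f x) \<le> poly ([:0, 1:] + p) (dsize x)" if "x \<in> D" for x
  proof -
    obtain s' where "runs c (\<lambda>_. x) (poly p (dsize x)) s'" "s' 0 = f x"
      using *[of "\<lambda>_. x"] \<open>x \<in> D\<close> by auto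
    then show ?thesis using runs_dsize[of c "\<lambda>_. x" "poly p (dsize x)" s' 0] by simp
  qed
  then show thesis by (rule that)
qed

lemma ptime_cong: "ptime D f \<Longrightarrow> (\<And>x. x \<in> D \<Longrightarrow> g x = f x) \<Longrightarrow> ptime D g"
  unfolding ptime_def by (metis (no_types, lifting))

section \<open>Elementary operations, composition, pairing and branching\<close>

lemma ptime_expr:
  assumes "poly_bounded b" and "\<And>s. eval e s = f (s 0)" and "\<And>s. cost e s \<le> b (dsize (s 0))"
  shows "ptime D f"
proof (rule ptimeI[where b = "\<lambda>n. 1 + b n" and m = 1 and c = "Assign 0 e"])
  show "poly_bounded (\<lambda>n. 1 + b n)" by (intro poly_bounded_intros assms)
  fix s :: state
  show "\<exists>s'. runs (Assign 0 e) s (1 + b (dsize (s 0))) s' \<and> s' 0 = f (s 0) \<and> (\<forall>y\<ge>1. s' y = s y)"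
    by (intro exI[of _ "s(0 := f (s 0))"] conjI runs_mono[OF runs_Assign])
      (use assms in auto)
qed

lemma ptime_id: "ptime D (\<lambda>x. x)"
  by (rule ptime_expr[where e = "Var 0" and b = "\<lambda>n. n"]) (auto intro: poly_bounded_intros)

lemma dsize_head_le: "dsize (head x) \<le> dsize x"
  by (cases x) auto

lemma dsize_tail_le: "dsize (tail x) \<le> dsize x"
  by (cases x) auto

lemma ptime_head0: "ptime D head"
  by (rule ptime_expr[where e = "HeadE (Var 0)" and b = "\<lambda>n. n + n"])
    (auto intro: poly_bounded_intros dsize_head_le)

lemma ptime_tail0: "ptime D tail"
  by (rule ptime_expr[where e = "TailE (Var 0)" and b = "\<lambda>n. n + n"])
    (auto intro: poly_bounded_intros dsize_tail_le)

lemma dsize_bool_data: "dsize (bool_data b) \<le> 3"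
  by (cases b) auto

lemma ptime_eq0: "ptime D (\<lambda>x. bool_data (head x = tail x))"
proof (rule ptime_expr[where e = "EqE (HeadE (Var 0)) (TailE (Var 0))" and b = "\<lambda>n. 4 * n + 3"])
  show "poly_bounded (\<lambda>n. 4 * n + 3)" by (intro poly_bounded_intros)
  show "cost (EqE (HeadE (Var 0)) (TailE (Var 0))) s \<le> 4 * dsize (s 0) + 3" for s
    using dsize_head_le[of "s 0"] dsize_tail_le[of "s 0"] dsize_bool_data[of "head (s 0) = tail (s 0)"]
    by simp
qed simp

lemma ptime_Leaf: "ptime D (\<lambda>_. Leaf)"
  by (rule ptime_expr[where e = "LeafE" and b = "\<lambda>n. 1"]) (auto intro: poly_bounded_intros)

text \<open>By \<open>runs_dsize\<close> the second program sees a value of size at most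
  \<open>n + poly p n\<close>, and polynomials are closed under this substitution.\<close>

lemma ptime_comp:
  assumes "ptime D f" "ptime E g" and "\<And>x. x \<in> D \<Longrightarrow> f x \<in> E"
  shows "ptime D (\<lambda>x. g (f x))"
proof -
  obtain c M and p :: "nat poly" where c: "\<And>s. s 0 \<in> D \<Longrightarrow>
    \<exists>s'. runs c s (poly p (dsize (s 0))) s' \<and> s' 0 = f (s 0) \<and> (\<forall>y\<ge>M. s' y = s y)"
    using ptimeE[OF assms(1)] by metis
  obtain d M' and q :: "nat poly" where d: "\<And>s. s 0 \<in> E \<Longrightarrow>
    \<exists>s'. runs d s (poly q (dsize (s 0))) s' \<and> s' 0 = g (s 0) \<and> (\<forall>y\<ge>M'. s' y = s y)"
    using ptimeE[OF assms(2)] by metis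
  show ?thesis
  proof (rule ptimeI[where b = "\<lambda>n. poly p n + poly q (n + poly p n)" and m = "max M M'"
        and c = "Seq c d"])
    show "poly_bounded (\<lambda>n. poly p n + poly q (n + poly p n))" by (intro poly_bounded_intros)
    fix s :: state assume s: "s 0 \<in> D"
    obtain s1 where s1: "runs c s (poly p (dsize (s 0))) s1" "s1 0 = f (s 0)" "\<forall>y\<ge>M. s1 y = s y"
      using c[of s] s by blast
    obtain s2 where s2: "runs d s1 (poly q (dsize (s1 0))) s2" "s2 0 = g (s1 0)"
      "\<forall>y\<ge>M'. s2 y = s1 y"
      using d[of s1] s1(2) assms(3)[OF s] by auto
    have "poly q (dsize (s1 0)) \<le> poly q (dsize (s 0) + poly p (dsize (s 0)))"
      by (intro poly_nat_mono runs_dsize[OF s1(1)])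
    then show "\<exists>s'. runs (Seq c d) s (poly p (dsize (s 0)) + poly q (dsize (s 0) + poly p (dsize (s 0)))) s' \<and>
        s' 0 = g (f (s 0)) \<and> (\<forall>y\<ge>max M M'. s' y = s y)"
      using s1 s2 by (intro exI[of _ s2] conjI runs_Seq[OF s1(1) runs_mono[OF s2(1)]]) auto
  qed
qed

lemma ptime_comp_UNIV: "ptime D f \<Longrightarrow> ptime UNIV g \<Longrightarrow> ptime D (\<lambda>x. g (f x))"
  by (rule ptime_comp) auto

lemma ptime_head: "ptime D f \<Longrightarrow> ptime D (\<lambda>x. head (f x))"
  and ptime_tail: "ptime D f \<Longrightarrow> ptime D (\<lambda>x. tail (f x))"
  by (rule ptime_comp_UNIV; auto intro: ptime_head0 ptime_tail0)+

text \<open>Registers \<open>m\<close> and \<open>m + 1\<close> lie beyond everything that either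
  program changes: \<open>m\<close> keeps the input for the second program, \<open>m + 1\<close> the
  first result while the second program runs.\<close>

lemma ptime_Node:
  assumes "ptime D f" "ptime D g"
  shows "ptime D (\<lambda>x. Node (f x) (g x))"
proof -
  obtain c M and p :: "nat poly" where M: "0 < M" and c: "\<And>s. s 0 \<in> D \<Longrightarrow>
    \<exists>s'. runs c s (poly p (dsize (s 0))) s' \<and> s' 0 = f (s 0) \<and> (\<forall>y\<ge>M. s' y = s y)"
    using ptimeE[OF assms(1)] by metis
  obtain d M' and q :: "nat poly" where d: "\<And>s. s 0 \<in> D \<Longrightarrow>
    \<exists>s'. runs d s (poly q (dsize (s 0))) s' \<and> s' 0 = g (s 0) \<and> (\<forall>y\<ge>M'. s' y = s y)"
    using ptimeE[OF assms(2)] by metis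
  define m where "m = max M M'"
  define prog where "prog = Seq (Assign m (Var 0)) (Seq c (Seq (Assign (m+1) (Var 0))
    (Seq (Assign 0 (Var m)) (Seq d (Assign 0 (NodeE (Var (m+1)) (Var 0)))))))"
  define b where "b n = (1 + n) + (poly p n + ((1 + (n + poly p n)) + ((1 + n) +
    (poly q n + (1 + (2 * (n + poly p n) + 2 * (n + poly q n) + 1))))))" for n
  show ?thesis
  proof (rule ptimeI[where b = b and m = "m + 2" and c = prog])
    show "poly_bounded b" unfolding b_def by (intro poly_bounded_intros)
    fix s :: state assume s: "s 0 \<in> D"
    let ?n = "dsize (s 0)"
    have m0: "m \<noteq> 0" "m \<ge> M" "m \<ge> M'" using M by (auto simp: m_def)
    define s1 where "s1 = s(m := s 0)"
    have r1: "runs (Assign m (Var 0)) s (1 + ?n) s1"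
      using runs_Assign[of s1 s m "Var 0"] by (simp add: s1_def)
    have s10: "s1 0 = s 0" "s1 m = s 0" using m0 by (auto simp: s1_def)
    obtain s2 where s2: "runs c s1 (poly p ?n) s2" "s2 0 = f (s 0)" "\<forall>y\<ge>M. s2 y = s1 y"
      using c[of s1] s s10 by auto
    have z2: "dsize (s2 0) \<le> ?n + poly p ?n" using runs_dsize[OF s2(1), of 0] s10 by simp
    define s3 where "s3 = s2(m+1 := s2 0)"
    have r3: "runs (Assign (m+1) (Var 0)) s2 (1 + (?n + poly p ?n)) s3"
      by (rule runs_mono[OF runs_Assign]) (use z2 in \<open>auto simp: s3_def\<close>)
    define s4 where "s4 = s3(0 := s3 m)"
    have "s2 m = s1 m" using s2(3) m0(2) by blast
    then have s3m: "s3 m = s 0" using s10(2) by (simp add: s3_def)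
    have r4: "runs (Assign 0 (Var m)) s3 (1 + ?n) s4"
      using runs_Assign[of s4 s3 0 "Var m"] by (simp add: s4_def s3m)
    have s40: "s4 0 = s 0" "s4 (m+1) = f (s 0)" using s2(2) s3m by (auto simp: s4_def s3_def)
    obtain s5 where s5: "runs d s4 (poly q ?n) s5" "s5 0 = g (s 0)" "\<forall>y\<ge>M'. s5 y = s4 y"
      using d[of s4] s s40 by auto
    have z5: "dsize (g (s 0)) \<le> ?n + poly q ?n" using runs_dsize[OF s5(1), of 0] s40 s5(2) by simp
    define s6 where "s6 = s5(0 := Node (f (s 0)) (g (s 0)))"
    have s5m: "s5 (m+1) = f (s 0)" using s5(3) s40 m0 by simp
    have r6: "runs (Assign 0 (NodeE (Var (m+1)) (Var 0))) s5
        (1 + (2 * (?n + poly p ?n) + 2 * (?n + poly q ?n) + 1)) s6"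
      by (rule runs_mono[OF runs_Assign]) (use z2 z5 s5m s5(2) s2(2) in \<open>auto simp: s6_def\<close>)
    have "runs prog s (b ?n) s6"
      unfolding prog_def b_def by (intro runs_Seq[OF r1] runs_Seq[OF s2(1)] runs_Seq[OF r3]
        runs_Seq[OF r4] runs_Seq[OF s5(1)] r6)
    moreover have "s6 y = s y" if "y \<ge> m + 2" for y
      using that m0 s5(3) s2(3) by (simp add: s6_def s4_def s3_def s1_def)
    ultimately show "\<exists>s'. runs prog s (b ?n) s' \<and> s' 0 = Node (f (s 0)) (g (s 0)) \<and>
        (\<forall>y\<ge>m + 2. s' y = s y)"
      by (intro exI[of _ s6]) (simp add: s6_def)
  qed
qed

lemma ptime_const: "ptime D (\<lambda>_. k)"
  by (induction k) (auto intro: ptime_Leaf ptime_Node)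

lemma ptime_eq:
  assumes "ptime D f" "ptime D g"
  shows "ptime D (\<lambda>x. bool_data (f x = g x))"
  using ptime_comp_UNIV[OF ptime_Node[OF assms] ptime_eq0] by simp

lemma ptime_if:
  assumes "ptime D (\<lambda>x. bool_data (P x))" "ptime D f" "ptime D g"
  shows "ptime D (\<lambda>x. if P x then f x else g x)"
proof -
  obtain c M and p :: "nat poly" where c: "\<And>s. s 0 \<in> D \<Longrightarrow>
    \<exists>s'. runs c s (poly p (dsize (s 0))) s' \<and> s' 0 = f (s 0) \<and> (\<forall>y\<ge>M. s' y = s y)"
    using ptimeE[OF assms(2)] by metis
  obtain d M' and q :: "nat poly" where d: "\<And>s. s 0 \<in> D \<Longrightarrow>
    \<exists>s'. runs d s (poly q (dsize (s 0))) s' \<and> s' 0 = g (s 0) \<and> (\<forall>y\<ge>M'. s' y = s y)"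
    using ptimeE[OF assms(3)] by metis
  define m where "m = Suc (max M M')"
  \<comment> \<open>The truth value is paired with the input, so that the test is evaluated before
    the branches; \<open>prog\<close> unpacks such a pair and restores the input before it enters
    one branch.\<close>
  define E where "E = (\<lambda>x. Node (bool_data (P x)) x) ` D"
  define prog where "prog = Seq (Assign m (HeadE (Var 0)))
    (Seq (Assign 0 (TailE (Var 0))) (Cond (Var m) c d))"
  define b where "b n = (1 + (n + n)) + ((1 + (n + n)) + (1 + n + (poly p n + poly q n)))" for n
  have "ptime E (\<lambda>z. if P (tail z) then f (tail z) else g (tail z))"
  proof (rule ptimeI[where b = b and m = "m + 1" and c = prog])
    show "poly_bounded b" unfolding b_def by (intro poly_bounded_intros)
    fix s :: state assume "s 0 \<in> E"
    then obtain x where x: "x \<in> D" "s 0 = Node (bool_data (P x)) x" by (auto simp: E_def)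
    let ?n = "dsize (s 0)"
    have m0: "m \<noteq> 0" "m \<ge> M" "m \<ge> M'" by (auto simp: m_def)
    define s1 where "s1 = s(m := bool_data (P x))"
    have r1: "runs (Assign m (HeadE (Var 0))) s (1 + (?n + ?n)) s1"
      by (rule runs_mono[OF runs_Assign]) (use x(2) in \<open>auto simp: s1_def\<close>)
    define s2 where "s2 = s1(0 := x)"
    have r2: "runs (Assign 0 (TailE (Var 0))) s1 (1 + (?n + ?n)) s2"
      by (rule runs_mono[OF runs_Assign]) (use x(2) m0 in \<open>auto simp: s1_def s2_def\<close>)
    have s20: "s2 0 = x" "s2 m = bool_data (P x)" using m0 by (auto simp: s1_def s2_def)
    have mono: "poly p (dsize x) \<le> poly p ?n" "poly q (dsize x) \<le> poly q ?n"
      by (intro poly_nat_mono; simp add: x(2))+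
    have "\<exists>s'. runs (if P x then c else d) s2 (poly p ?n + poly q ?n) s' \<and>
        s' 0 = (if P x then f x else g x) \<and> (\<forall>y\<ge>m. s' y = s2 y)"
    proof (cases "P x")
      case True
      then show ?thesis using c[of s2] x(1) s20 mono m0
        by simp (meson le_trans runs_mono trans_le_add1)
    next
      case False
      then show ?thesis using d[of s2] x(1) s20 mono m0
        by simp (meson le_trans runs_mono trans_le_add2)
    qed
    then obtain s3 where s3: "runs (if P x then c else d) s2 (poly p ?n + poly q ?n) s3"
      "s3 0 = (if P x then f x else g x)" "\<forall>y\<ge>m. s3 y = s2 y" by blast
    have "runs (Cond (Var m) c d) s2 (1 + cost (Var m) s2 + (poly p ?n + poly q ?n)) s3"
      by (rule runs_Cond) (use s3(1) s20 in \<open>cases "P x"; simp\<close>)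
    then have r3: "runs (Cond (Var m) c d) s2 (1 + ?n + (poly p ?n + poly q ?n)) s3"
      by (rule runs_mono) (use s20 x(2) in simp)
    have "runs prog s (b ?n) s3"
      unfolding prog_def b_def by (intro runs_Seq[OF r1] runs_Seq[OF r2] r3)
    moreover have "\<forall>y\<ge>m + 1. s3 y = s y" using s3(3) m0 by (auto simp: s1_def s2_def)
    ultimately show "\<exists>s'. runs prog s (b ?n) s' \<and>
        s' 0 = (if P (tail (s 0)) then f (tail (s 0)) else g (tail (s 0))) \<and> (\<forall>y\<ge>m + 1. s' y = s y)"
      using s3(2) x(2) by auto
  qed
  from ptime_comp[OF ptime_Node[OF assms(1) ptime_id] this]
  have "ptime D (\<lambda>x. if P x then f (tail (Node (bool_data (P x)) x)) else g (tail (Node (bool_data (P x)) x)))"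
    by (simp add: E_def)
  then show ?thesis by (simp only: tail.simps)
qed

lemma ptime_not: "ptime D (\<lambda>x. bool_data (P x)) \<Longrightarrow> ptime D (\<lambda>x. bool_data (\<not> P x))"
  by (rule ptime_cong[OF ptime_if[OF _ ptime_const[of D "bool_data False"]
    ptime_const[of D "bool_data True"]]]) auto

lemma ptime_disj:
  "ptime D (\<lambda>x. bool_data (P x)) \<Longrightarrow> ptime D (\<lambda>x. bool_data (Q x)) \<Longrightarrow>
    ptime D (\<lambda>x. bool_data (P x \<or> Q x))"
  by (rule ptime_cong[OF ptime_if[of D P "\<lambda>_. bool_data True" "\<lambda>x. bool_data (Q x)"]])
    (auto intro: ptime_const simp del: bool_data.simps)

section \<open>Independence of a run from variables that the program does not mention\<close>

primrec expr_bound :: "expr \<Rightarrow> nat" where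
  "expr_bound (Var x) = Suc x"
| "expr_bound LeafE = 0"
| "expr_bound (NodeE e f) = max (expr_bound e) (expr_bound f)"
| "expr_bound (HeadE e) = expr_bound e"
| "expr_bound (TailE e) = expr_bound e"
| "expr_bound (EqE e f) = max (expr_bound e) (expr_bound f)"

primrec com_bound :: "com \<Rightarrow> nat" where
  "com_bound Skip = 0"
| "com_bound (Assign x e) = max (Suc x) (expr_bound e)"
| "com_bound (Seq c d) = max (com_bound c) (com_bound d)"
| "com_bound (Cond e c d) = max (expr_bound e) (max (com_bound c) (com_bound d))"
| "com_bound (While e c) = max (expr_bound e) (com_bound c)"

lemma expr_frame:
  assumes "expr_bound e \<le> m" "\<And>y. y < m \<Longrightarrow> r y = s y"
  shows "eval e r = eval e s \<and> cost e r = cost e s"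
  using assms by (induction e) auto

text \<open>Expressions and assignments only touch variables below \<open>com_bound c\<close>, so a
  run can be replayed step by step, at equal cost, in a state with other contents above. This frees
  the neighbour program from the clean start that \<open>computes_within\<close> prescribes.\<close>

lemma exec_frame:
  assumes "exec c s t s'" "com_bound c \<le> m" "\<And>y. y < m \<Longrightarrow> r y = s y"
  shows "\<exists>r'. exec c r t r' \<and> (\<forall>y<m. r' y = s' y) \<and> (\<forall>y\<ge>m. r' y = r y)"
  using assms
proof (induction arbitrary: r rule: exec.induct)
  case (Skip s)
  then show ?case using exec.Skip by blast
next
  case (Assign x e s)
  then have "eval e r = eval e s" "cost e r = cost e s" using expr_frame[of e m r s] by auto
  then have "exec (Assign x e) r (1 + cost e s) (r(x := eval e s))"
    using exec.Assign[of x e r] by simp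
  moreover have "\<forall>y<m. (r(x := eval e s)) y = (s(x := eval e s)) y"
    "\<forall>y\<ge>m. (r(x := eval e s)) y = r y"
    using Assign by auto
  ultimately show ?case by blast
next
  case (Seq c s t s' d t' s'')
  obtain r1 where r1: "exec c r t r1" "\<forall>y<m. r1 y = s' y" "\<forall>y\<ge>m. r1 y = r y"
    using Seq.IH(1)[of r] Seq.prems by auto
  obtain r2 where "exec d r1 t' r2" "\<forall>y<m. r2 y = s'' y" "\<forall>y\<ge>m. r2 y = r1 y"
    using Seq.IH(2)[of r1] Seq.prems r1 by auto
  then show ?case using r1 exec.Seq by (intro exI[of _ r2]) auto
next
  case (CondTrue e s c t s' d)
  then have e: "eval e r = eval e s" "cost e r = cost e s" using expr_frame[of e m r s] by auto
  obtain r1 where "exec c r t r1" "\<forall>y<m. r1 y = s' y" "\<forall>y\<ge>m. r1 y = r y"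
    using CondTrue.IH[of r] CondTrue.prems by auto
  then show ?case using e CondTrue.hyps exec.CondTrue[of e r c t r1 d]
    by (intro exI[of _ r1]) auto
next
  case (CondFalse e s d t s' c)
  then have e: "eval e r = eval e s" "cost e r = cost e s" using expr_frame[of e m r s] by auto
  obtain r1 where "exec d r t r1" "\<forall>y<m. r1 y = s' y" "\<forall>y\<ge>m. r1 y = r y"
    using CondFalse.IH[of r] CondFalse.prems by auto
  then show ?case using e CondFalse.hyps exec.CondFalse[of e r d t r1 c]
    by (intro exI[of _ r1]) auto
next
  case (WhileFalse e s c)
  then have e: "eval e r = eval e s" "cost e r = cost e s" using expr_frame[of e m r s] by auto
  then show ?case using WhileFalse exec.WhileFalse[of e r c] by (intro exI[of _ r]) auto
next
  case (WhileTrue e s c t s' t' s'')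
  then have e: "eval e r = eval e s" "cost e r = cost e s" using expr_frame[of e m r s] by auto
  obtain r1 where r1: "exec c r t r1" "\<forall>y<m. r1 y = s' y" "\<forall>y\<ge>m. r1 y = r y"
    using WhileTrue.IH(1)[of r] WhileTrue.prems by auto
  obtain r2 where "exec (While e c) r1 t' r2" "\<forall>y<m. r2 y = s'' y" "\<forall>y\<ge>m. r2 y = r1 y"
    using WhileTrue.IH(2)[of r1] WhileTrue.prems r1 by auto
  then show ?case using e r1 WhileTrue.hyps exec.WhileTrue[of e r c t r1 t' r2]
    by (intro exI[of _ r2]) auto
qed

primrec clear :: "nat \<Rightarrow> com" where
  "clear 0 = Skip"
| "clear (Suc k) = Seq (Assign (Suc k) LeafE) (clear k)"

lemma runs_clear: "runs (clear k) s (2 * k + 1) (\<lambda>y. if 1 \<le> y \<and> y \<le> k then Leaf else s y)"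
proof (induction k arbitrary: s)
  case 0
  have "(\<lambda>y. if 1 \<le> y \<and> y \<le> (0::nat) then Leaf else s y) = s" by auto
  then show ?case using exec.Skip[of s] unfolding runs_def by auto
next
  case (Suc k)
  have "(\<lambda>y. if 1 \<le> y \<and> y \<le> k then Leaf else (s(Suc k := Leaf)) y) =
      (\<lambda>y. if 1 \<le> y \<and> y \<le> Suc k then Leaf else s y)" by (auto simp: fun_eq_iff)
  then show ?case
    using runs_Seq[OF runs_Assign[of "s(Suc k := Leaf)" s "Suc k" LeafE] Suc[of "s(Suc k := Leaf)"]]
    by simp
qed

text \<open>\<open>computes_within\<close> speaks of the start in which all variables but
  \<open>0\<close> are \<open>Leaf\<close>, \<open>ptime\<close> of arbitrary starts. Clearing the
  variables that \<open>c\<close> may mention, at constant cost, makes the two agree as far as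
  \<open>exec_frame\<close> requires.\<close>

lemma ptime_of_computes_within:
  assumes "\<And>x. x \<in> D \<Longrightarrow> computes_within c x (f x) (poly p (dsize x))"
  shows "ptime D f"
proof (rule ptimeI[where b = "\<lambda>n. (2 * com_bound c + 1) + poly p n" and m = "Suc (com_bound c)"
      and c = "Seq (clear (com_bound c)) c"])
  let ?k = "com_bound c"
  show "poly_bounded (\<lambda>n. (2 * ?k + 1) + poly p n)" by (intro poly_bounded_intros)
  fix s :: state assume s: "s 0 \<in> D"
  obtain t s' where t: "exec c ((\<lambda>_. Leaf)(0 := s 0)) t s'" "s' 0 = f (s 0)"
    "t \<le> poly p (dsize (s 0))"
    using assms[OF s] unfolding computes_within_def by blast
  let ?r = "\<lambda>y. if 1 \<le> y \<and> y \<le> ?k then Leaf else s y"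
  obtain r' where r': "exec c ?r t r'" "\<forall>y<Suc ?k. r' y = s' y" "\<forall>y\<ge>Suc ?k. r' y = ?r y"
    using exec_frame[OF t(1), of "Suc ?k" ?r] by (force simp: less_Suc_eq_le)
  have "runs (Seq (clear ?k) c) s ((2 * ?k + 1) + poly p (dsize (s 0))) r'"
    by (rule runs_Seq[OF runs_clear]) (use r'(1) t(3) in \<open>auto simp: runs_def\<close>)
  then show "\<exists>s'. runs (Seq (clear ?k) c) s ((2 * ?k + 1) + poly p (dsize (s 0))) s' \<and>
      s' 0 = f (s 0) \<and> (\<forall>y\<ge>Suc ?k. s' y = s y)"
    using r' t(2) by (intro exI[of _ r']) auto
qed

lemma poly_time_solvable_if_ptime:
  assumes "ptime D f" "\<And>x i. (x, i) \<in> C \<Longrightarrow> x \<in> D \<and> f x = bool_data (Q i)"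
  shows "poly_time_solvable C Q"
proof -
  obtain c M and p :: "nat poly" where c: "\<And>s. s 0 \<in> D \<Longrightarrow>
    \<exists>s'. runs c s (poly p (dsize (s 0))) s' \<and> s' 0 = f (s 0) \<and> (\<forall>y\<ge>M. s' y = s y)"
    using ptimeE[OF assms(1)] by metis
  have "computes_within c x (bool_data (Q i)) (poly p (dsize x))" if "(x, i) \<in> C" for x i
    using c[of "(\<lambda>_. Leaf)(0 := x)"] assms(2)[OF that]
    unfolding computes_within_def runs_def by auto
  then show ?thesis unfolding poly_time_solvable_def by blast
qed


section \<open>Polynomial-time list operations\<close>

text \<open>Every data value is the spine of exactly one list.\<close>

primrec items :: "data \<Rightarrow> data list" where
  "items Leaf = []"
| "items (Node a b) = a # items b"

lemma items_list_data [simp]: "items (list_data xs) = xs"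
  by (induction xs) auto

lemma list_data_items [simp]: "list_data (items d) = d"
  by (induction d) auto

lemma list_data_eq_Leaf [simp]: "list_data xs = Leaf \<longleftrightarrow> xs = []"
  by (cases xs) auto

lemma dsize_list_data: "dsize (list_data xs) = Suc (\<Sum>x\<leftarrow>xs. Suc (dsize x))"
  by (induction xs) auto

lemma length_le_dsize: "length xs \<le> dsize (list_data xs)"
  by (induction xs) auto

lemma dsize_mem_list_data: "x \<in> set xs \<Longrightarrow> dsize x \<le> dsize (list_data xs)"
  by (induction xs) auto

lemma dsize_list_data_le:
  assumes "\<And>x. x \<in> set xs \<Longrightarrow> dsize x \<le> k"
  shows "dsize (list_data xs) \<le> Suc (length xs * Suc k)"
proof -
  have "(\<Sum>x\<leftarrow>xs. Suc (dsize x)) \<le> (\<Sum>x\<leftarrow>xs. Suc k)"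
    using assms by (intro sum_list_mono) auto
  then show ?thesis by (simp add: dsize_list_data sum_list_replicate map_replicate_const)
qed

section \<open>Iteration along a list\<close>

definition fold_com :: "nat \<Rightarrow> com \<Rightarrow> com" where
  "fold_com m c = Seq (Assign 0 (NodeE (Var m) (NodeE (HeadE (Var (m+1))) (Var (m+2)))))
    (Seq c (Seq (Assign (m+2) (Var 0)) (Assign (m+1) (TailE (Var (m+1))))))"

text \<open>Register \<open>m\<close> holds the fixed parameter \<open>x\<close>,
  \<open>m + 1\<close> the rest of the list and \<open>m + 2\<close> the accumulator. The domain and
  size hypotheses range over prefixes because the accumulator is always a fold over a prefix.
  \<open>W\<close> adds up one pass: loop test, loading the argument, the body on an argument of
  size at most \<open>3 * K + 2\<close>, storing the result, dropping the head of the list. The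
  final failing test costs \<open>2\<close>.\<close>

lemma runs_fold_com:
  fixes p :: "nat poly"
  assumes c: "\<And>s. s 0 \<in> E \<Longrightarrow>
      \<exists>s'. runs c s (poly p (dsize (s 0))) s' \<and> s' 0 = g (s 0) \<and> (\<forall>y\<ge>m. s' y = s y)"
    and m: "0 < m"
    and x: "dsize x \<le> K"
    and W: "W = (1 + K) + ((9 * K + 4) + (poly p (3 * K + 2) + ((1 + K) + (1 + 2 * K))))"
  shows "s m = x \<Longrightarrow> s (m+1) = list_data ys \<Longrightarrow> s (m+2) = acc \<Longrightarrow>
    (\<And>us h vs. ys = us @ h # vs \<Longrightarrow>
      Node x (Node h (fold (\<lambda>h acc. g (Node x (Node h acc))) us acc)) \<in> E) \<Longrightarrow>
    (\<And>us vs. ys = us @ vs \<Longrightarrow> dsize (fold (\<lambda>h acc. g (Node x (Node h acc))) us acc) \<le> K) \<Longrightarrow>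
    dsize (list_data ys) \<le> K \<Longrightarrow>
    \<exists>s'. runs (While (Var (m+1)) (fold_com m c)) s (length ys * W + 2) s' \<and>
      s' (m+2) = fold (\<lambda>h acc. g (Node x (Node h acc))) ys acc \<and> (\<forall>y\<ge>m+3. s' y = s y)"
proof (induction ys arbitrary: s acc)
  case Nil
  have "runs (While (Var (m+1)) (fold_com m c)) s (1 + cost (Var (m+1)) s) s"
    by (rule runs_While_Leaf) (use Nil.prems(2) in simp)
  then show ?case using Nil.prems by (intro exI[of _ s]) simp
next
  case (Cons h ys)
  let ?G = "\<lambda>h acc. g (Node x (Node h acc))"
  have acc: "dsize acc \<le> K" using Cons.prems(5)[of "[]"] by simp
  have acc1: "dsize (?G h acc) \<le> K" using Cons.prems(5)[of "[h]" ys] by simp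
  have E: "Node x (Node h acc) \<in> E" using Cons.prems(4)[of "[]" h ys] by simp
  have sz: "dsize h \<le> K" "dsize (list_data ys) \<le> K" "Suc (dsize h + dsize (list_data ys)) \<le> K"
    using Cons.prems(6) by auto
  define s1 where "s1 = s(0 := Node x (Node h acc))"
  have r1: "runs (Assign 0 (NodeE (Var m) (NodeE (HeadE (Var (m+1))) (Var (m+2))))) s (9 * K + 4) s1"
    by (rule runs_mono[OF runs_Assign]) (use Cons.prems(1-3) acc sz x in \<open>auto simp: s1_def\<close>)
  have "s1 0 = Node x (Node h acc)" by (simp add: s1_def)
  then obtain s2 where s2: "runs c s1 (poly p (dsize (Node x (Node h acc)))) s2" "s2 0 = ?G h acc"
    "\<forall>y\<ge>m. s2 y = s1 y" using c[of s1] E by auto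
  have "poly p (dsize (Node x (Node h acc))) \<le> poly p (3 * K + 2)"
    by (rule poly_nat_mono) (use acc sz x in simp)
  then have r2: "runs c s1 (poly p (3 * K + 2)) s2" using s2(1) runs_mono by blast
  define s3 where "s3 = s2(m+2 := ?G h acc)"
  have r3: "runs (Assign (m+2) (Var 0)) s2 (1 + K) s3"
    by (rule runs_mono[OF runs_Assign]) (use s2(2) acc1 in \<open>auto simp: s3_def\<close>)
  have "s2 (m+1) = s1 (m+1)" "s2 m = s1 m" using s2(3) by auto
  then have s3v: "s3 (m+1) = list_data (h # ys)" "s3 m = x"
    using m Cons.prems(1,2) by (auto simp: s3_def s1_def)
  define s4 where "s4 = s3(m+1 := list_data ys)"
  have r4: "runs (Assign (m+1) (TailE (Var (m+1)))) s3 (1 + 2 * K) s4"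
    by (rule runs_mono[OF runs_Assign]) (use s3v sz in \<open>auto simp: s4_def\<close>)
  have body: "runs (fold_com m c) s ((9 * K + 4) + (poly p (3 * K + 2) + ((1 + K) + (1 + 2 * K)))) s4"
    unfolding fold_com_def by (intro runs_Seq[OF r1] runs_Seq[OF r2] runs_Seq[OF r3] r4)
  have s4v: "s4 m = x" "s4 (m+1) = list_data ys" "s4 (m+2) = ?G h acc"
    using s3v by (auto simp: s4_def s3_def)
  have "\<exists>s'. runs (While (Var (m+1)) (fold_com m c)) s4 (length ys * W + 2) s' \<and>
      s' (m+2) = fold ?G ys (?G h acc) \<and> (\<forall>y\<ge>m+3. s' y = s4 y)"
  proof (rule Cons.IH[OF s4v])
    show "Node x (Node h' (fold ?G us (?G h acc))) \<in> E" if "ys = us @ h' # vs" for us h' vs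
      using Cons.prems(4)[of "h # us" h' vs] that by simp
    show "dsize (fold ?G us (?G h acc)) \<le> K" if "ys = us @ vs" for us vs
      using Cons.prems(5)[of "h # us" vs] that by simp
  qed (use sz in simp)
  then obtain s' where s': "runs (While (Var (m+1)) (fold_com m c)) s4 (length ys * W + 2) s'"
    "s' (m+2) = fold ?G ys (?G h acc)" "\<forall>y\<ge>m+3. s' y = s4 y" by blast
  have "runs (While (Var (m+1)) (fold_com m c)) s (1 + cost (Var (m+1)) s +
      ((9 * K + 4) + (poly p (3 * K + 2) + ((1 + K) + (1 + 2 * K)))) + (length ys * W + 2)) s'"
    by (rule runs_While[OF _ body s'(1)]) (use Cons.prems(2) in simp)
  then have "runs (While (Var (m+1)) (fold_com m c)) s (length (h # ys) * W + 2) s'"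
    by (rule runs_mono) (use Cons.prems(2) sz(3) in \<open>simp add: W\<close>)
  moreover have "\<forall>y\<ge>m+3. s' y = s y"
    using s'(3) s2(3) m by (auto simp: s4_def s3_def s1_def)
  ultimately show ?case using s'(2) by (intro exI[of _ s']) simp
qed

text \<open>The bound \<open>b\<close> refers to the original input and covers the accumulators of
  all prefixes; this excludes repeated doubling. Likewise \<open>dom\<close> keeps the body away
  from arguments on which it may diverge.\<close>

lemma ptime_fold:
  fixes l :: "data \<Rightarrow> data list" and g :: "data \<Rightarrow> data \<Rightarrow> data \<Rightarrow> data"
  assumes l: "ptime D (\<lambda>x. list_data (l x))" and a: "ptime D a"
    and g: "ptime E (\<lambda>z. g (head z) (head (tail z)) (tail (tail z)))"
    and dom: "\<And>x us h vs. x \<in> D \<Longrightarrow> l x = us @ h # vs \<Longrightarrow> Node x (Node h (fold (g x) us (a x))) \<in> E"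
    and b: "poly_bounded b"
    and size: "\<And>x us vs. x \<in> D \<Longrightarrow> l x = us @ vs \<Longrightarrow> dsize (fold (g x) us (a x)) \<le> b (dsize x)"
  shows "ptime D (\<lambda>x. fold (g x) (l x) (a x))"
proof -
  define T where "T = (\<lambda>x. Node x (Node (list_data (l x)) (a x)))"
  obtain q :: "nat poly" where q: "\<And>n. b n \<le> poly q n" using b unfolding poly_bounded_def by blast
  obtain c m and p :: "nat poly" where m: "0 < m" and c: "\<And>s. s 0 \<in> E \<Longrightarrow>
    \<exists>s'. runs c s (poly p (dsize (s 0))) s' \<and>
      s' 0 = g (head (s 0)) (head (tail (s 0))) (tail (tail (s 0))) \<and> (\<forall>y\<ge>m. s' y = s y)"
    using ptimeE[OF g] by metis
  define prog where "prog = Seq (Assign m (HeadE (Var 0))) (Seq (Assign (m+1) (HeadE (TailE (Var 0))))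
    (Seq (Assign (m+2) (TailE (TailE (Var 0)))) (Seq (While (Var (m+1)) (fold_com m c))
    (Assign 0 (Var (m+2))))))"
  define W where "W n = (let K = n + poly q n in
    (1 + K) + ((9 * K + 4) + (poly p (3 * K + 2) + ((1 + K) + (1 + 2 * K)))))" for n
  define B where "B n = (1 + 3 * n) + ((1 + 3 * n) + ((1 + 3 * n) + ((n * W n + 2) +
    (1 + (n + poly q n)))))" for n
  have "ptime (T ` D) (\<lambda>z. fold (g (head z)) (items (head (tail z))) (tail (tail z)))"
  proof (rule ptimeI[where b = B and m = "m + 3" and c = prog])
    show "poly_bounded B" unfolding B_def W_def Let_def by (intro poly_bounded_intros)
    fix s :: state assume "s 0 \<in> T ` D"
    then obtain x where x: "x \<in> D" and s0: "s 0 = Node x (Node (list_data (l x)) (a x))"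
      by (auto simp: T_def)
    let ?n = "dsize (s 0)"
    define s1 where "s1 = s(m := x)"
    have r1: "runs (Assign m (HeadE (Var 0))) s (1 + 3 * ?n) s1"
      by (rule runs_mono[OF runs_Assign]) (use s0 in \<open>auto simp: s1_def\<close>)
    define s2 where "s2 = s1(m+1 := list_data (l x))"
    have r2: "runs (Assign (m+1) (HeadE (TailE (Var 0)))) s1 (1 + 3 * ?n) s2"
      by (rule runs_mono[OF runs_Assign]) (use s0 m in \<open>auto simp: s2_def s1_def\<close>)
    define s3 where "s3 = s2(m+2 := a x)"
    have r3: "runs (Assign (m+2) (TailE (TailE (Var 0)))) s2 (1 + 3 * ?n) s3"
      by (rule runs_mono[OF runs_Assign]) (use s0 m in \<open>auto simp: s3_def s2_def s1_def\<close>)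
    have bnd: "b (dsize x) \<le> ?n + poly q ?n"
      using q[of "dsize x"] poly_nat_mono[of "dsize x" ?n q] s0 by simp
    have "\<exists>s'. runs (While (Var (m+1)) (fold_com m c)) s3 (length (l x) * W ?n + 2) s' \<and>
        s' (m+2) = fold (\<lambda>h acc. g (head (Node x (Node h acc))) (head (tail (Node x (Node h acc))))
          (tail (tail (Node x (Node h acc))))) (l x) (a x) \<and> (\<forall>y\<ge>m+3. s' y = s3 y)"
      by (rule runs_fold_com[where K = "?n + poly q ?n", OF c m])
        (use x dom size[OF x] bnd s0 in
          \<open>auto simp: s3_def s2_def s1_def W_def Let_def intro: order_trans[OF size[OF x]]\<close>)
    then obtain s4 where s4: "runs (While (Var (m+1)) (fold_com m c)) s3 (length (l x) * W ?n + 2) s4"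
      "s4 (m+2) = fold (g x) (l x) (a x)" "\<forall>y\<ge>m+3. s4 y = s3 y" by auto
    have "length (l x) \<le> ?n" using length_le_dsize[of "l x"] s0 by simp
    then have r4: "runs (While (Var (m+1)) (fold_com m c)) s3 (?n * W ?n + 2) s4"
      by (intro runs_mono[OF s4(1)]) simp
    define s5 where "s5 = s4(0 := fold (g x) (l x) (a x))"
    have r5: "runs (Assign 0 (Var (m+2))) s4 (1 + (?n + poly q ?n)) s5"
      by (rule runs_mono[OF runs_Assign]) (use s4(2) size[OF x, of "l x"] bnd in \<open>auto simp: s5_def\<close>)
    have "runs prog s (B ?n) s5"
      unfolding prog_def B_def
      by (intro runs_Seq[OF r1] runs_Seq[OF r2] runs_Seq[OF r3] runs_Seq[OF r4] r5)
    moreover have "\<forall>y\<ge>m+3. s5 y = s y" using s4(3) by (auto simp: s5_def s3_def s2_def s1_def)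
    ultimately show "\<exists>s'. runs prog s (B ?n) s' \<and>
        s' 0 = fold (g (head (s 0))) (items (head (tail (s 0)))) (tail (tail (s 0))) \<and>
        (\<forall>y\<ge>m+3. s' y = s y)"
      by (intro exI[of _ s5]) (simp add: s0 s5_def)
  qed
  from ptime_comp[OF ptime_Node[OF ptime_id ptime_Node[OF l a]] this] show ?thesis
    by (simp add: T_def)
qed

lemma fold_Node: "fold (\<lambda>h acc. Node h acc) us (list_data b) = list_data (rev us @ b)"
  by (induction us arbitrary: b) (auto, metis list_data.simps(2))

text \<open>Pushing elements onto an accumulator reverses them, so this is the primitive operation
  from which reversal and append are derived.\<close>

lemma ptime_rev_append:
  assumes "ptime D (\<lambda>x. list_data (a x))" "ptime D (\<lambda>x. list_data (b x))"
  shows "ptime D (\<lambda>x. list_data (rev (a x) @ b x))"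
proof -
  have "ptime UNIV (\<lambda>z. fold (\<lambda>h acc. Node h acc) (items (head z)) (tail z))"
  proof (rule ptime_fold[where g = "\<lambda>_ h acc. Node h acc" and E = UNIV and b = "\<lambda>n. n + n"])
    show "poly_bounded (\<lambda>n. n + n)" by (intro poly_bounded_intros)
    fix x us vs assume "items (head x) = us @ vs"
    then have "dsize (list_data us) \<le> dsize (list_data (items (head x)))"
      by (simp add: dsize_list_data del: list_data_items)
    then have "dsize (list_data us) \<le> dsize x" using dsize_head_le[of x] by simp
    moreover have "dsize (tail x) \<le> dsize x" by (rule dsize_tail_le)
    moreover have "dsize (fold (\<lambda>h acc. Node h acc) us (tail x)) + 1 =
        dsize (list_data us) + dsize (tail x)"
      using fold_Node[of us "items (tail x)"] dsize_list_data[of "items (tail x)"]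
      by (simp add: dsize_list_data rev_map[symmetric])
    ultimately show "dsize (fold (\<lambda>h acc. Node h acc) us (tail x)) \<le> dsize x + dsize x" by simp
  next
    show "ptime UNIV (\<lambda>z. Node (head (tail z)) (tail (tail z)))"
      by (intro ptime_Node ptime_head ptime_tail ptime_id)
  next
    show "ptime UNIV tail" by (intro ptime_tail0)
  next
    show "ptime UNIV (\<lambda>x. list_data (items (head x)))" by (simp add: ptime_head0)
  qed simp
  from ptime_comp_UNIV[OF ptime_Node[OF assms] this] show ?thesis by (simp add: fold_Node)
qed

lemma ptime_rev: "ptime D (\<lambda>x. list_data (a x)) \<Longrightarrow> ptime D (\<lambda>x. list_data (rev (a x)))"
  using ptime_rev_append[of D a "\<lambda>_. []"] by (simp add: ptime_Leaf)

lemma ptime_append: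
  "ptime D (\<lambda>x. list_data (a x)) \<Longrightarrow> ptime D (\<lambda>x. list_data (b x)) \<Longrightarrow>
    ptime D (\<lambda>x. list_data (a x @ b x))"
  using ptime_rev_append[OF ptime_rev] by simp

text \<open>The fold runs over the reversed list because each block is put in front of the
  accumulator. There are at most \<open>poly p n\<close> blocks, and the size of each is polynomial
  in that of the parameter and the element.\<close>

lemma ptime_concat_map:
  assumes l: "ptime D (\<lambda>x. list_data (l x))"
    and f: "ptime E (\<lambda>z. list_data (f (head z) (tail z)))"
    and dom: "\<And>x h. x \<in> D \<Longrightarrow> h \<in> set (l x) \<Longrightarrow> Node x h \<in> E"
  shows "ptime D (\<lambda>x. list_data (concat (map (f x) (l x))))"
proof -
  let ?g = "\<lambda>x h acc. list_data (f x h @ items acc)"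
  let ?E = "{Node x (Node h acc) |x h acc. Node x h \<in> E}"
  obtain p where p: "\<And>x. x \<in> D \<Longrightarrow> dsize (list_data (l x)) \<le> poly p (dsize x)"
    using ptime_dsize[OF l] by blast
  obtain q where q: "\<And>z. z \<in> E \<Longrightarrow> dsize (list_data (f (head z) (tail z))) \<le> poly q (dsize z)"
    using ptime_dsize[OF f] by blast
  have fold: "fold (?g x) us Leaf = list_data (concat (map (f x) (rev us)))" for x us
    by (induction us rule: rev_induct) auto
  have "ptime D (\<lambda>x. fold (?g x) (rev (l x)) Leaf)"
  proof (rule ptime_fold[where E = ?E and b = "\<lambda>n. 1 + poly p n * poly q (n + poly p n + 1)"])
    show "poly_bounded (\<lambda>n. 1 + poly p n * poly q (n + poly p n + 1))" by (intro poly_bounded_intros)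
    have "ptime ?E (\<lambda>z. Node (head z) (head (tail z)))"
      by (intro ptime_Node ptime_head ptime_tail ptime_id)
    have "ptime ?E (\<lambda>z. list_data (f (head (Node (head z) (head (tail z))))
        (tail (Node (head z) (head (tail z))))))"
      by (rule ptime_comp[OF \<open>ptime ?E (\<lambda>z. Node (head z) (head (tail z)))\<close> f]) auto
    then have "ptime ?E (\<lambda>z. list_data (f (head z) (head (tail z))))" by simp
    then show "ptime ?E (\<lambda>z. ?g (head z) (head (tail z)) (tail (tail z)))"
      by (rule ptime_append) (simp add: ptime_tail ptime_id)
    show "Node x (Node h (fold (?g x) us Leaf)) \<in> ?E"
      if "x \<in> D" "rev (l x) = us @ h # vs" for x us h vs
    proof -
      have "h \<in> set (l x)" using arg_cong[OF that(2), of set] by simp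
      then show ?thesis using dom that(1) by blast
    qed
    fix x us vs assume x: "x \<in> D" and us: "rev (l x) = us @ vs"
    let ?n = "dsize x"
    have len: "length us \<le> poly p ?n"
      using arg_cong[OF us, of length] length_le_dsize[of "l x"] p[OF x] by simp
    have sub: "set us \<subseteq> set (l x)" using arg_cong[OF us, of set] by auto
    have each: "dsize (list_data (f x h)) \<le> poly q (?n + poly p ?n + 1)" if "h \<in> set us" for h
    proof -
      have h: "h \<in> set (l x)" using that sub by blast
      have "dsize (list_data (f x h)) \<le> poly q (dsize (Node x h))"
        using q[OF dom[OF x h]] by simp
      also have "\<dots> \<le> poly q (?n + poly p ?n + 1)"
        by (rule poly_nat_mono) (use dsize_mem_list_data[OF h] p[OF x] in simp)
      finally show ?thesis .
    qed
    have "dsize (list_data (concat (map (f x) us))) \<le> 1 + length us * poly q (?n + poly p ?n + 1)"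
      using each by (induction us) (fastforce simp: dsize_list_data)+
    moreover have "length us * poly q (?n + poly p ?n + 1) \<le> poly p ?n * poly q (?n + poly p ?n + 1)"
      using len by (rule mult_le_mono1)
    moreover have "dsize (list_data (concat (map (f x) (rev us)))) = dsize (list_data (concat (map (f x) us)))"
      by (induction us) (auto simp: dsize_list_data)
    ultimately show "dsize (fold (?g x) us Leaf) \<le> 1 + poly p ?n * poly q (?n + poly p ?n + 1)"
      unfolding fold by linarith
  qed (use ptime_rev[OF l] ptime_Leaf in auto)
  then show ?thesis by (simp add: fold)
qed

lemma ptime_map:
  assumes "ptime D (\<lambda>x. list_data (l x))" "ptime E (\<lambda>z. f (head z) (tail z))"
    and "\<And>x h. x \<in> D \<Longrightarrow> h \<in> set (l x) \<Longrightarrow> Node x h \<in> E"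
  shows "ptime D (\<lambda>x. list_data (map (f x) (l x)))"
proof -
  have "ptime E (\<lambda>z. list_data [f (head z) (tail z)])"
    using ptime_Node[OF assms(2) ptime_Leaf] by simp
  from ptime_concat_map[OF assms(1) this assms(3)] show ?thesis by (simp add: concat_map_singleton)
qed

lemma ptime_filter:
  assumes "ptime D (\<lambda>x. list_data (l x))" "ptime E (\<lambda>z. bool_data (P (head z) (tail z)))"
    and "\<And>x h. x \<in> D \<Longrightarrow> h \<in> set (l x) \<Longrightarrow> Node x h \<in> E"
  shows "ptime D (\<lambda>x. list_data (filter (P x) (l x)))"
proof -
  have "ptime E (\<lambda>z. list_data (if P (head z) (tail z) then [tail z] else []))"
    using ptime_if[OF assms(2) ptime_Node[OF ptime_tail[OF ptime_id] ptime_Leaf] ptime_Leaf]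
    by (rule ptime_cong) simp
  from ptime_concat_map[OF assms(1) this assms(3)]
  have "ptime D (\<lambda>x. list_data (concat (map (\<lambda>h. if P x h then [h] else []) (l x))))" .
  moreover have "concat (map (\<lambda>h. if Q h then [h] else []) xs) = filter Q xs" for Q and xs :: "data list"
    by (induction xs) auto
  ultimately show ?thesis by simp
qed

lemma ptime_Bex:
  assumes "ptime D (\<lambda>x. list_data (l x))" "ptime UNIV (\<lambda>z. bool_data (P (head z) (tail z)))"
  shows "ptime D (\<lambda>x. bool_data (\<exists>h\<in>set (l x). P x h))"
proof -
  have "ptime D (\<lambda>x. bool_data (\<not> list_data (filter (P x) (l x)) = Leaf))"
    by (intro ptime_not ptime_eq ptime_filter[OF assms] ptime_Leaf) simp
  then show ?thesis by (rule ptime_cong) (auto simp: filter_empty_conv)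
qed

lemma ptime_member:
  assumes "ptime D a" "ptime D (\<lambda>x. list_data (l x))"
  shows "ptime D (\<lambda>x. bool_data (a x \<in> set (l x)))"
proof -
  have "ptime UNIV (\<lambda>z. bool_data (\<exists>h\<in>set (items (tail z)). h = head z))"
    by (rule ptime_Bex, simp add: ptime_tail0) (intro ptime_eq ptime_head ptime_tail ptime_id)
  from ptime_comp_UNIV[OF ptime_Node[OF assms] this] show ?thesis by simp
qed

text \<open>Horner's rule in unary: \<open>poly (pCons a p) k = a + k * poly p k\<close>, where the
  product is a concatenation of \<open>k\<close> blocks. It supplies the counter for the rounds that
  build the region.\<close>

lemma ptime_replicate_poly:
  assumes k: "ptime D (\<lambda>x. list_data (replicate (k x) Leaf))"
  shows "ptime D (\<lambda>x. list_data (replicate (poly p (k x)) Leaf))"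
proof (induction p)
  case 0
  show ?case by (simp add: ptime_Leaf)
next
  case (pCons a p)
  have c: "concat (replicate i (replicate j y)) = replicate (i * j) y" for i j and y :: data
    by (induction i) (auto simp: replicate_add)
  let ?E = "{Node x h |x h. x \<in> D}"
  have "ptime ?E (\<lambda>z. list_data (replicate (poly p (k (head z))) Leaf))"
    by (rule ptime_comp[OF ptime_head[OF ptime_id] pCons(2)]) auto
  then have "ptime D (\<lambda>x. list_data (replicate a Leaf @
      concat (map (\<lambda>_. replicate (poly p (k x)) Leaf) (replicate (k x) Leaf))))"
    by (intro ptime_append ptime_const ptime_concat_map[OF k, where E = ?E]) auto
  then show ?case by (simp add: c map_replicate_const replicate_add)
qed

lemma ptime_items: "ptime D f \<Longrightarrow> ptime D (\<lambda>x. list_data (items (f x)))"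
  by simp

lemma ptime_map_UNIV:
  "ptime D (\<lambda>x. list_data (l x)) \<Longrightarrow> ptime UNIV (\<lambda>z. f (head z) (tail z)) \<Longrightarrow>
    ptime D (\<lambda>x. list_data (map (f x) (l x)))"
  by (rule ptime_map) auto

lemma ptime_filter_UNIV:
  "ptime D (\<lambda>x. list_data (l x)) \<Longrightarrow> ptime UNIV (\<lambda>z. bool_data (P (head z) (tail z))) \<Longrightarrow>
    ptime D (\<lambda>x. list_data (filter (P x) (l x)))"
  by (rule ptime_filter) auto

lemma ptime_concat_map_UNIV:
  "ptime D (\<lambda>x. list_data (l x)) \<Longrightarrow> ptime UNIV (\<lambda>z. list_data (f (head z) (tail z))) \<Longrightarrow>
    ptime D (\<lambda>x. list_data (concat (map (f x) (l x))))"
  by (rule ptime_concat_map) auto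

lemma ptime_Cons:
  "ptime D a \<Longrightarrow> ptime D (\<lambda>x. list_data (l x)) \<Longrightarrow> ptime D (\<lambda>x. list_data (a x # l x))"
  using ptime_Node by simp

lemma ptime_if_list:
  "ptime D (\<lambda>x. bool_data (P x)) \<Longrightarrow> ptime D (\<lambda>x. list_data (a x)) \<Longrightarrow>
    ptime D (\<lambda>x. list_data (b x)) \<Longrightarrow> ptime D (\<lambda>x. list_data (if P x then a x else b x))"
  by (rule ptime_cong[OF ptime_if[of D P "\<lambda>x. list_data (a x)" "\<lambda>x. list_data (b x)"]]) auto

lemma ptime_eq_Nil:
  "ptime D (\<lambda>x. list_data (l x)) \<Longrightarrow> ptime D (\<lambda>x. bool_data (l x = []))"
  using ptime_eq[OF _ ptime_Leaf, of D "\<lambda>x. list_data (l x)"] by simp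

lemmas ptime_intros =
  ptime_items ptime_map_UNIV ptime_filter_UNIV ptime_concat_map_UNIV ptime_Cons ptime_if_list
  ptime_eq_Nil ptime_append ptime_member ptime_Bex ptime_disj ptime_not ptime_eq
  ptime_Node ptime_head ptime_tail ptime_id

lemma fold_list_data:
  assumes "\<And>h d. g h d = list_data (f h (items d))"
  shows "fold g us (list_data b) = list_data (fold f us b)"
  by (induction us arbitrary: b) (auto simp: assms)


section \<open>Minimum cuts by augmenting paths\<close>

text \<open>An arc from \<open>u\<close> to \<open>w\<close> is \<open>Node u w\<close>, and a flow is a list \<open>F\<close> of arcs. An entry
  \<open>Node w as\<close> of the list \<open>R\<close> records that \<open>w\<close> is reached from a source through the arcs
  \<open>as\<close> (last arc first), none of which is in \<open>F\<close>.\<close>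

definition search :: "data list \<Rightarrow> data \<Rightarrow> data list \<Rightarrow> data list" where
  "search F a R =
     (if a \<in> set F \<or> (\<exists>r\<in>set R. head r = tail a) \<or> filter (\<lambda>r. head r = head a) R = [] then R
      else Node (tail a) (Node a (tail (head (list_data (filter (\<lambda>r. head r = head a) R))))) # R)"

text \<open>Every shortest residual path has at most \<open>length A\<close> arcs, so \<open>length A\<close> rounds
  over all arcs reach every reachable vertex.\<close>

definition visited :: "data list \<Rightarrow> data list \<Rightarrow> data list \<Rightarrow> data list" where
  "visited F S A = fold (search F) (concat (map (\<lambda>_. A) A)) (map (\<lambda>v. Node v Leaf) S)"

text \<open>Every vertex outside \<open>X\<close> is a sink, so these entries are the completed
  augmenting paths.\<close>

definition found :: "data list \<Rightarrow> data list \<Rightarrow> data list \<Rightarrow> data list \<Rightarrow> data list" where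
  "found A X S F = filter (\<lambda>r. \<not> head r \<in> set X) (visited F S A)"

text \<open>Capacities are one: flow on the reversed arc is cancelled if there is any, and only
  otherwise is the arc itself used.\<close>

definition augment :: "data \<Rightarrow> data list \<Rightarrow> data list" where
  "augment a F = (if Node (tail a) (head a) \<in> set F
     then filter (\<lambda>b. \<not> b = Node (tail a) (head a)) F else a # F)"

text \<open>Without an augmenting path, \<open>head Leaf = Leaf\<close> makes the list of arcs empty.\<close>

definition augment_step :: "data list \<Rightarrow> data list \<Rightarrow> data list \<Rightarrow> data list \<Rightarrow> data list" where
  "augment_step A X S F = fold augment (items (tail (head (list_data (found A X S F))))) F"

text \<open>\<open>Bs\<close> is a unary counter of rounds; with the budget in its place, the flow
  value never exceeds the budget.\<close>

definition max_flow :: "data list \<Rightarrow> data list \<Rightarrow> data list \<Rightarrow> data list \<Rightarrow> data list" where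
  "max_flow A X S Bs = fold (\<lambda>_. augment_step A X S) Bs []"

section \<open>Size and time bounds for the path search\<close>

lemma ptime_search:
  "ptime UNIV (\<lambda>z. list_data (search (items (head z)) (head (tail z)) (items (tail (tail z)))))"
  unfolding search_def by (intro ptime_intros)

lemma length_search: "length (search F a R) \<le> Suc (length R)"
  by (simp add: search_def)

lemma length_fold_search: "length (fold (search F) us R) \<le> length R + length us"
proof (induction us arbitrary: R)
  case (Cons a us)
  show ?case using length_search[of F a R] Cons[of "search F a R"] by simp
qed simp

text \<open>A new entry copies a stored path and adds one arc, one vertex and two nodes. Sizes
  therefore grow additively over the search.\<close>

lemma dsize_search:
  assumes "\<And>r. r \<in> set R \<Longrightarrow> dsize r \<le> k" "dsize a \<le> c" "r \<in> set (search F a R)"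
  shows "dsize r \<le> k + (2 * c + 2)"
proof (cases "r \<in> set R")
  case True
  then show ?thesis using assms(1) by fastforce
next
  case False
  let ?Q = "filter (\<lambda>r. head r = head a) R"
  have Q: "?Q \<noteq> []" "r = Node (tail a) (Node a (tail (head (list_data ?Q))))"
    using False assms(3) by (auto simp: search_def split: if_splits)
  then have "head (list_data ?Q) \<in> set ?Q" by (cases ?Q) auto
  then have "dsize (tail (head (list_data ?Q))) \<le> k"
    using assms(1) dsize_tail_le order_trans by fastforce
  then show ?thesis using Q(2) assms(2) dsize_tail_le[of a] by simp
qed

lemma dsize_fold_search:
  assumes "\<And>r. r \<in> set R \<Longrightarrow> dsize r \<le> k" "\<And>a. a \<in> set us \<Longrightarrow> dsize a \<le> c"
    "r \<in> set (fold (search F) us R)"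
  shows "dsize r \<le> k + length us * (2 * c + 2)"
  using assms
proof (induction us arbitrary: R k)
  case (Cons a us)
  have "dsize r \<le> (k + (2 * c + 2)) + length us * (2 * c + 2)"
  proof (rule Cons.IH[of "search F a R"])
    show "dsize r' \<le> k + (2 * c + 2)" if "r' \<in> set (search F a R)" for r'
      using dsize_search[of R k a c r' F] Cons.prems that by simp
  qed (use Cons.prems in auto)
  then show ?case by simp
qed simp

lemma concat_prefix_bounds:
  assumes "concat (map (\<lambda>_. A) A) = us @ vs"
  shows "length us \<le> length A * length A" "set us \<subseteq> set A"
proof -
  have "length (concat (map (\<lambda>_. A) A)) = length A * length A"
    by (simp add: length_concat sum_list_replicate map_replicate_const)
  then show "length us \<le> length A * length A" using assms by simp
  show "set us \<subseteq> set A" using arg_cong[OF assms, of set] by (auto split: if_splits)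
qed

text \<open>\<open>n + 2\<close> bounds the initial entries \<open>Node v Leaf\<close>; the second
  summand is the growth over at most \<open>n * n\<close> search steps.\<close>

lemma dsize_visited_prefix:
  assumes "concat (map (\<lambda>_. A) A) = us @ vs" "dsize (list_data S) \<le> n" "dsize (list_data A) \<le> n"
    and "r \<in> set (fold (search F) us (map (\<lambda>v. Node v Leaf) S))"
  shows "dsize r \<le> (n + 2) + n * n * (2 * n + 2)"
proof -
  have "dsize r \<le> (n + 2) + length us * (2 * n + 2)"
  proof (rule dsize_fold_search[OF _ _ assms(4)])
    show "dsize r \<le> n + 2" if "r \<in> set (map (\<lambda>v. Node v Leaf) S)" for r
      using that dsize_mem_list_data[of _ S] assms(2) by fastforce
    show "dsize a \<le> n" if "a \<in> set us" for a
      using that concat_prefix_bounds(2)[OF assms(1)] dsize_mem_list_data[of a A] assms(3) by auto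
  qed
  moreover have "length us \<le> n * n"
    using concat_prefix_bounds(1)[OF assms(1)] length_le_dsize[of A] assms(3)
    by (meson le_trans mult_le_mono)
  ultimately show ?thesis
    by (meson add_left_mono le_trans mult_le_mono1)
qed

lemma ptime_visited0:
  "ptime UNIV (\<lambda>z. list_data (visited (items (head z)) (items (head (tail z))) (items (tail (tail z)))))"
proof -
  let ?g = "\<lambda>z a acc. list_data (search (items (head z)) a (items acc))"
  let ?l = "\<lambda>z. concat (map (\<lambda>_. items (tail (tail z))) (items (tail (tail z))))"
  let ?i = "\<lambda>z. list_data (map (\<lambda>v. Node v Leaf) (items (head (tail z))))"
  have fold: "fold (?g z) us (list_data R) = list_data (fold (search (items (head z))) us R)" for z us R
    by (rule fold_list_data) simp
  have "ptime UNIV (\<lambda>z. fold (?g z) (?l z) (?i z))"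
  proof (rule ptime_fold[where E = UNIV and
        b = "\<lambda>n. Suc ((n + n * n) * Suc ((n + 2) + n * n * (2 * n + 2)))"])
    show "ptime UNIV (\<lambda>x. list_data (?l x))" by (intro ptime_intros)
    show "ptime UNIV ?i" by (intro ptime_intros ptime_Leaf)
    have "ptime UNIV (\<lambda>z. Node (head (head z)) (Node (head (tail z)) (tail (tail z))))"
      by (intro ptime_intros)
    from ptime_comp_UNIV[OF this ptime_search]
    show "ptime UNIV (\<lambda>z. ?g (head z) (head (tail z)) (tail (tail z)))" by simp
    show "poly_bounded (\<lambda>n. Suc ((n + n * n) * Suc ((n + 2) + n * n * (2 * n + 2))))"
      by (intro poly_bounded_intros)
    fix z us vs assume us: "?l z = us @ vs"
    let ?n = "dsize z"
    let ?R = "fold (search (items (head z))) us (map (\<lambda>v. Node v Leaf) (items (head (tail z))))"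
    have S: "dsize (list_data (items (head (tail z)))) \<le> ?n"
      and A: "dsize (list_data (items (tail (tail z)))) \<le> ?n"
      using le_trans[OF dsize_head_le dsize_tail_le] le_trans[OF dsize_tail_le dsize_tail_le]
      by simp_all
    have "dsize (list_data ?R) \<le> Suc (length ?R * Suc ((?n + 2) + ?n * ?n * (2 * ?n + 2)))"
      by (rule dsize_list_data_le) (rule dsize_visited_prefix[OF us S A])
    moreover have "length ?R \<le> ?n + ?n * ?n"
    proof -
      have "length us \<le> ?n * ?n"
        using concat_prefix_bounds(1)[OF us] A
          length_le_dsize[of "items (tail (tail z))"] by (meson le_trans mult_le_mono)
      moreover have "length (items (head (tail z))) \<le> ?n" using S length_le_dsize le_trans by blast
      ultimately show ?thesis
        using length_fold_search[of "items (head z)" us "map (\<lambda>v. Node v Leaf) (items (head (tail z)))"]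
        by simp
    qed
    ultimately have "dsize (list_data ?R) \<le> Suc ((?n + ?n * ?n) * Suc ((?n + 2) + ?n * ?n * (2 * ?n + 2)))"
      by (meson Suc_le_mono le_trans mult_le_mono1)
    then show "dsize (fold (?g z) us (?i z)) \<le>
        Suc ((?n + ?n * ?n) * Suc ((?n + 2) + ?n * ?n * (2 * ?n + 2)))"
      unfolding fold .
  qed auto
  then show ?thesis unfolding fold visited_def .
qed

lemma ptime_visited:
  assumes "ptime D (\<lambda>x. list_data (F x))" "ptime D (\<lambda>x. list_data (S x))" "ptime D (\<lambda>x. list_data (A x))"
  shows "ptime D (\<lambda>x. list_data (visited (F x) (S x) (A x)))"
  using ptime_comp_UNIV[OF ptime_Node[OF assms(1) ptime_Node[OF assms(2,3)]] ptime_visited0] by simp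

lemma ptime_found0:
  "ptime UNIV (\<lambda>z. list_data (found (items (head z)) (items (head (tail z)))
    (items (head (tail (tail z)))) (items (tail (tail (tail z))))))"
  unfolding found_def by (intro ptime_visited ptime_intros)

lemma ptime_found:
  assumes "ptime D (\<lambda>x. list_data (A x))" "ptime D (\<lambda>x. list_data (X x))"
    "ptime D (\<lambda>x. list_data (S x))" "ptime D (\<lambda>x. list_data (F x))"
  shows "ptime D (\<lambda>x. list_data (found (A x) (X x) (S x) (F x)))"
  using ptime_comp_UNIV[OF ptime_Node[OF assms(1) ptime_Node[OF assms(2) ptime_Node[OF assms(3,4)]]]
    ptime_found0] by simp

lemma dsize_augment: "dsize (list_data (augment a F)) \<le> dsize (list_data F) + Suc (dsize a)"
proof -
  have "dsize (list_data (filter P F)) \<le> dsize (list_data F)" for P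
    by (induction F) auto
  then show ?thesis by (auto simp: augment_def intro: le_SucI trans_le_add1)
qed

lemma dsize_fold_augment:
  "dsize (list_data (fold augment us F)) \<le> dsize (list_data F) + dsize (list_data us)"
proof (induction us arbitrary: F)
  case (Cons a us)
  show ?case using dsize_augment[of a F] Cons[of "augment a F"] by simp
qed simp

lemma ptime_fold_augment:
  assumes "ptime D a" "ptime D (\<lambda>x. list_data (F x))"
  shows "ptime D (\<lambda>x. list_data (fold augment (items (a x)) (F x)))"
proof -
  let ?g = "\<lambda>_ a acc. list_data (augment a (items acc))"
  have fold: "fold (?g z) us d = list_data (fold augment us (items d))" for z :: data and us d
    using fold_list_data[of "?g z" augment us "items d"] by simp
  have "ptime UNIV (\<lambda>z. fold (?g z) (items (head z)) (tail z))"
  proof (rule ptime_fold[where E = UNIV and b = "\<lambda>n. n + n"])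
    show "ptime UNIV (\<lambda>z. ?g (head z) (head (tail z)) (tail (tail z)))"
      unfolding augment_def by (intro ptime_intros)
    fix z us vs assume "items (head z) = us @ vs"
    then have "dsize (list_data us) \<le> dsize (list_data (items (head z)))"
      by (simp add: dsize_list_data del: list_data_items)
    then have "dsize (list_data us) \<le> dsize z" using dsize_head_le[of z] by simp
    then show "dsize (fold (?g z) us (tail z)) \<le> dsize z + dsize z"
      unfolding fold using dsize_fold_augment[of us "items (tail z)"] dsize_tail_le[of z]
      by simp
  qed (intro ptime_intros poly_bounded_intros UNIV_I)+
  then have "ptime UNIV (\<lambda>z. list_data (fold augment (items (head z)) (items (tail z))))"
    unfolding fold .
  from ptime_comp_UNIV[OF ptime_Node[OF assms] this] show ?thesis by simp
qed

text \<open>The bound on the increase does not involve the current flow, so the flow keeps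
  polynomial size over all rounds.\<close>

lemma dsize_augment_step:
  assumes "dsize (list_data S) \<le> n" "dsize (list_data A) \<le> n"
  shows "dsize (list_data (augment_step A X S F)) \<le>
    dsize (list_data F) + ((n + 2) + n * n * (2 * n + 2))"
proof -
  let ?r = "head (list_data (found A X S F))"
  have "dsize ?r \<le> (n + 2) + n * n * (2 * n + 2)"
  proof (cases "found A X S F")
    case (Cons r rs)
    then have "r \<in> set (visited F S A)"
      unfolding found_def by (metis filter_is_subset list.set_intros(1) subsetD)
    then show ?thesis
      using dsize_visited_prefix[of A "concat (map (\<lambda>_. A) A)" "[]" S n r F] assms Cons
      by (simp add: visited_def)
  qed simp
  then show ?thesis
    unfolding augment_step_def
    using dsize_fold_augment[of "items (tail ?r)" F] dsize_tail_le[of ?r] by simp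
qed

lemma ptime_max_flow:
  assumes "ptime D (\<lambda>x. list_data (A x))" "ptime D (\<lambda>x. list_data (X x))"
    "ptime D (\<lambda>x. list_data (S x))" "ptime D (\<lambda>x. list_data (Bs x))"
  shows "ptime D (\<lambda>x. list_data (max_flow (A x) (X x) (S x) (Bs x)))"
proof -
  let ?A = "\<lambda>z. items (head z)" and ?X = "\<lambda>z. items (head (tail z))"
    and ?S = "\<lambda>z. items (head (tail (tail z)))" and ?B = "\<lambda>z. items (tail (tail (tail z)))"
  let ?g = "\<lambda>z _ acc. list_data (augment_step (?A z) (?X z) (?S z) (items acc))"
  have fold: "fold (?g z) us Leaf = list_data (fold (\<lambda>_. augment_step (?A z) (?X z) (?S z)) us [])"
    for z and us :: "data list"
    using fold_list_data[of "?g z" "\<lambda>_. augment_step (?A z) (?X z) (?S z)" us "[]"] by simp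
  have "ptime UNIV (\<lambda>z. fold (?g z) (?B z) Leaf)"
  proof (rule ptime_fold[where E = UNIV and b = "\<lambda>n. 1 + n * ((n + 2) + n * n * (2 * n + 2))"])
    show "ptime UNIV (\<lambda>z. ?g (head z) (head (tail z)) (tail (tail z)))"
      unfolding augment_step_def by (intro ptime_fold_augment ptime_found ptime_intros)
    fix z us vs assume us: "?B z = us @ vs"
    let ?n = "dsize z"
    let ?F = "\<lambda>us. fold (\<lambda>_. augment_step (?A z) (?X z) (?S z)) (us :: data list)"
    have S: "dsize (list_data (?S z)) \<le> ?n" and A: "dsize (list_data (?A z)) \<le> ?n"
      and B: "dsize (list_data (?B z)) \<le> ?n"
      using dsize_head_le[of z] le_trans[OF le_trans[OF dsize_head_le dsize_tail_le] dsize_tail_le]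
        le_trans[OF le_trans[OF dsize_tail_le dsize_tail_le] dsize_tail_le]
      by simp_all
    have "dsize (list_data (?F us F)) \<le> dsize (list_data F) + length us * ((?n + 2) + ?n * ?n * (2 * ?n + 2))"
      for F
    proof (induction us arbitrary: F)
      case (Cons b us)
      show ?case
        using Cons[of "augment_step (?A z) (?X z) (?S z) F"] dsize_augment_step[OF S A, of "?X z" F]
        by simp
    qed simp
    from this[of "[]"] have "dsize (list_data (?F us [])) \<le> 1 + length us * ((?n + 2) + ?n * ?n * (2 * ?n + 2))"
      by simp
    moreover have "length us \<le> ?n" using us length_le_dsize[of "?B z"] B by simp
    ultimately show "dsize (fold (?g z) us Leaf) \<le> 1 + ?n * ((?n + 2) + ?n * ?n * (2 * ?n + 2))"
      unfolding fold by (meson add_left_mono le_trans mult_le_mono1)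
  qed (intro ptime_intros ptime_Leaf poly_bounded_intros UNIV_I)+
  then have "ptime UNIV (\<lambda>z. list_data (max_flow (?A z) (?X z) (?S z) (?B z)))"
    unfolding fold max_flow_def .
  from ptime_comp_UNIV[OF ptime_Node[OF assms(1) ptime_Node[OF assms(2) ptime_Node[OF assms(3,4)]]] this]
  show ?thesis by simp
qed

lemma ptime_no_augmenting_path:
  assumes "ptime D (\<lambda>x. list_data (A x))" "ptime D (\<lambda>x. list_data (X x))"
    "ptime D (\<lambda>x. list_data (S x))" "ptime D (\<lambda>x. list_data (Bs x))"
  shows "ptime D (\<lambda>x. bool_data (found (A x) (X x) (S x) (max_flow (A x) (X x) (S x) (Bs x)) = []))"
  by (intro ptime_eq_Nil ptime_found ptime_max_flow assms)

section \<open>Correctness of the flow computation: flows and cuts\<close>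

definition flip :: "data \<Rightarrow> data" where
  "flip a = Node (tail a) (head a)"

text \<open>Signed so that a sum over a flow counts what leaves \<open>U\<close> minus what
  returns.\<close>

definition crossing :: "data set \<Rightarrow> data \<Rightarrow> int" where
  "crossing U a = of_bool (head a \<in> U) - of_bool (tail a \<in> U)"

text \<open>All arcs start in \<open>X\<close>. Those that end outside lead to a sink and have no
  reverse, so reversal is demanded inside \<open>X\<close> only.\<close>

locale network =
  fixes A X S :: "data list"
  assumes arc: "a \<in> set A \<Longrightarrow> \<exists>u w. a = Node u w \<and> u \<noteq> w \<and> u \<in> set X"
    and flip_arc: "a \<in> set A \<Longrightarrow> tail a \<in> set X \<Longrightarrow> flip a \<in> set A"
begin

definition flow :: "data list \<Rightarrow> bool" where
  "flow F \<longleftrightarrow> set F \<subseteq> set A \<and> (\<forall>a\<in>set F. flip a \<notin> set F)"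

definition net :: "data set \<Rightarrow> data list \<Rightarrow> int" where
  "net U F = (\<Sum>a\<in>set F. crossing U a)"

lemma flip_flip: "a \<in> set A \<Longrightarrow> flip (flip a) = a"
  using arc[of a] by (auto simp: flip_def)

lemma flip_neq: "a \<in> set A \<Longrightarrow> flip a \<noteq> a"
  using arc[of a] by (auto simp: flip_def)

text \<open>In the cancelling case the net flow changes by \<open>- crossing U (flip a)\<close>,
  which equals \<open>crossing U a\<close>; both cases thus have the same effect.\<close>

lemma augment_flow:
  assumes F: "flow F" and a: "a \<in> set A" "a \<notin> set F"
  shows "flow (augment a F)" "net U (augment a F) = net U F + crossing U a"
    "set (augment a F) \<subseteq> insert a (set F)"
proof -
  have "flow (augment a F) \<and> net U (augment a F) = net U F + crossing U a"
  proof (cases "flip a \<in> set F")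
    case True
    then have s: "set (augment a F) = set F - {flip a}" by (auto simp: augment_def flip_def)
    have "crossing U (flip a) = - crossing U a" by (simp add: crossing_def flip_def)
    then show ?thesis using F True s by (auto simp: flow_def net_def sum_diff1)
  next
    case False
    then have s: "set (augment a F) = insert a (set F)" by (auto simp: augment_def flip_def)
    have "flip b \<noteq> a" if "b \<in> set F" for b
      using that False F a flip_flip[of b] by (auto simp: flow_def)
    then show ?thesis
      using F False a s flip_neq[OF a(1)] by (auto simp: flow_def net_def)
  qed
  then show "flow (augment a F)" "net U (augment a F) = net U F + crossing U a" by auto
  show "set (augment a F) \<subseteq> insert a (set F)" by (auto simp: augment_def)
qed

text \<open>Since \<open>augment a\<close> adds no arc other than \<open>a\<close>, distinct arcs
  outside \<open>F\<close> remain outside the flow until their turn.\<close>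

lemma fold_augment_flow:
  assumes "flow F" "set as \<subseteq> set A" "distinct as" "set as \<inter> set F = {}"
  shows "flow (fold augment as F)"
    "net U (fold augment as F) = net U F + (\<Sum>a\<leftarrow>as. crossing U a)"
proof -
  have "flow (fold augment as F) \<and>
      net U (fold augment as F) = net U F + (\<Sum>a\<leftarrow>as. crossing U a)"
    using assms
  proof (induction as arbitrary: F)
    case (Cons a as)
    have "a \<in> set A" "a \<notin> set F" using Cons.prems by auto
    note aug = augment_flow[OF Cons.prems(1) this]
    have "set as \<inter> set (augment a F) = {}" using aug(3) Cons.prems(3,4) by auto
    then have "flow (fold augment as (augment a F)) \<and> net U (fold augment as (augment a F)) =
        net U (augment a F) + (\<Sum>a\<leftarrow>as. crossing U a)"
      using Cons.IH[OF aug(1)] Cons.prems(2,3) by auto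
    then show ?case using aug(2)[of U] by simp
  qed simp
  then show "flow (fold augment as F)"
    "net U (fold augment as F) = net U F + (\<Sum>a\<leftarrow>as. crossing U a)" by auto
qed

definition residual :: "data list \<Rightarrow> (data \<times> data) set" where
  "residual F = {(u, w). Node u w \<in> set A - set F}"

primrec walk :: "data list \<Rightarrow> data \<Rightarrow> data list \<Rightarrow> bool" where
  "walk F v [] \<longleftrightarrow> v \<in> set S"
| "walk F v (a # as) \<longleftrightarrow> a \<in> set A - set F \<and> tail a = v \<and> walk F (head a) as"

lemma walk_subset: "walk F v as \<Longrightarrow> set as \<subseteq> set A - set F"
  by (induction as arbitrary: v) auto

text \<open>Telescoping along a path that starts in \<open>U\<close>: departures and returns
  alternate, so the sum only sees whether the end \<open>v\<close> lies outside
  \<open>U\<close>.\<close>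

lemma walk_crossing:
  "walk F v as \<Longrightarrow> set S \<subseteq> U \<Longrightarrow> (\<Sum>a\<leftarrow>as. crossing U a) = 1 - of_bool (v \<in> U)"
  by (induction as arbitrary: v) (auto simp: crossing_def)

lemma walk_reachable: "walk F v as \<Longrightarrow> \<exists>s\<in>set S. (s, v) \<in> (residual F)\<^sup>*"
proof (induction as arbitrary: v)
  case (Cons a as)
  then obtain s where s: "s \<in> set S" "(s, head a) \<in> (residual F)\<^sup>*" by auto
  have "(head a, v) \<in> residual F" using Cons.prems arc[of a] by (auto simp: residual_def)
  then show ?case using s by (meson rtrancl.rtrancl_into_rtrancl)
qed auto

text \<open>The last clause keeps the arcs of a path distinct: a newly reached vertex is not yet
  listed, so the arc that ends in it cannot occur on the path being extended.\<close>

definition entries :: "data list \<Rightarrow> data list \<Rightarrow> bool" where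
  "entries F R \<longleftrightarrow> (\<forall>r\<in>set R. walk F (head r) (items (tail r)) \<and> distinct (items (tail r)) \<and>
     (\<forall>a\<in>set (items (tail r)). tail a \<in> head ` set R))"

lemma entries_search:
  assumes R: "entries F R" and a: "a \<in> set A"
  shows "entries F (search F a R)"
proof -
  let ?Q = "filter (\<lambda>r. head r = head a) R"
  show ?thesis
  proof (cases "a \<in> set F \<or> (\<exists>r\<in>set R. head r = tail a) \<or> ?Q = []")
    case True
    then show ?thesis using R by (simp add: search_def)
  next
    case False
    define r where "r = head (list_data ?Q)"
    have "r \<in> set ?Q" unfolding r_def using False by (cases ?Q) auto
    then have r: "r \<in> set R" "head r = head a" by auto
    have "a \<notin> set (items (tail r))" using R r False by (fastforce simp: entries_def)
    moreover have "search F a R = Node (tail a) (Node a (tail r)) # R"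
      using False by (simp add: search_def r_def)
    ultimately show ?thesis using R r a False by (auto simp: entries_def)
  qed
qed

lemma entries_fold_search:
  "entries F R \<Longrightarrow> set us \<subseteq> set A \<Longrightarrow> entries F (fold (search F) us R)"
  by (induction us arbitrary: R) (auto simp: entries_search)

lemma entries_visited: "entries F (visited F S A)"
  unfolding visited_def by (rule entries_fold_search) (auto simp: entries_def)

lemma search_mono: "set R \<subseteq> set (search F a R)"
  by (auto simp: search_def)

lemma fold_search_mono: "set R \<subseteq> set (fold (search F) us R)"
  by (induction us arbitrary: R) (auto dest: subsetD[OF search_mono])

lemma search_extends:
  "a \<notin> set F \<Longrightarrow> head a \<in> head ` set R \<Longrightarrow> tail a \<in> head ` set (search F a R)"
  by (auto simp: search_def filter_empty_conv image_iff) metis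

lemma fold_search_extends:
  assumes "a \<in> set us" "a \<notin> set F" "head a \<in> head ` set R"
  shows "tail a \<in> head ` set (fold (search F) us R)"
proof -
  obtain us1 us2 where us: "us = us1 @ a # us2" using split_list[OF assms(1)] by blast
  have "head a \<in> head ` set (fold (search F) us1 R)" using assms(3) fold_search_mono by blast
  then have "tail a \<in> head ` set (search F a (fold (search F) us1 R))"
    using search_extends assms(2) by blast
  then show ?thesis using us fold_search_mono by fastforce
qed

text \<open>One pass over all arcs follows at least the next arc of a residual path, whatever the
  order of the arcs. The list \<open>l\<close> counts the passes.\<close>

lemma fold_search_reaches:
  assumes "(u, w) \<in> residual F ^^ k" "k \<le> length l" "u \<in> head ` set R"
  shows "w \<in> head ` set (fold (search F) (concat (map (\<lambda>_. A) l)) R)"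
  using assms
proof (induction l arbitrary: u k R)
  case Nil
  then show ?case by simp
next
  case (Cons b l)
  show ?case
  proof (cases k)
    case 0
    then show ?thesis using Cons.prems fold_search_mono by fastforce
  next
    case (Suc j)
    then obtain v where v: "(u, v) \<in> residual F" "(v, w) \<in> residual F ^^ j"
      using Cons.prems(1) relpow_Suc_D2 by metis
    have "v \<in> head ` set (fold (search F) A R)"
      using fold_search_extends[of "Node u v" A F R] v(1) Cons.prems(3) by (simp add: residual_def)
    then show ?thesis using Cons.IH[OF v(2)] Suc Cons.prems(2) by simp
  qed
qed

text \<open>Soundness comes from the walks stored in the entries. For completeness, residual pairs
  embed into the arcs, so \<open>rtrancl_finite_eq_relpow\<close> bounds the required path lengths
  by \<open>length A\<close>.\<close>

lemma heads_visited: "head ` set (visited F S A) = (residual F)\<^sup>* `` set S"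
proof
  show "head ` set (visited F S A) \<subseteq> (residual F)\<^sup>* `` set S"
    using entries_visited[of F] walk_reachable by (fastforce simp: entries_def)
  show "(residual F)\<^sup>* `` set S \<subseteq> head ` set (visited F S A)"
  proof
    fix w assume "w \<in> (residual F)\<^sup>* `` set S"
    then obtain s where s: "s \<in> set S" "(s, w) \<in> (residual F)\<^sup>*" by blast
    have img: "(\<lambda>(u, w). Node u w) ` residual F \<subseteq> set A" by (auto simp: residual_def)
    have inj: "inj_on (\<lambda>(u, w). Node u w) (residual F)" by (auto simp: inj_on_def)
    have fin: "finite (residual F)" using img inj finite_imageD finite_subset by blast
    have "card (residual F) \<le> card (set A)" using card_inj_on_le[OF inj img] by simp
    then have card: "card (residual F) \<le> length A" using card_length le_trans by blast
    obtain k where "k \<le> card (residual F)" "(s, w) \<in> residual F ^^ k"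
      using s(2) rtrancl_finite_eq_relpow[OF fin] by auto
    then show "w \<in> head ` set (visited F S A)"
      unfolding visited_def using s(1) card
      by (intro fold_search_reaches[where u = s and k = k]) (auto simp: image_iff)
  qed
qed

text \<open>Conservation at vertices is replaced by its consequence for cuts: the net flow out of
  every \<open>U\<close> between \<open>S\<close> and \<open>X\<close> is the same number. This form
  serves both halves of the duality.\<close>

definition flow_value :: "data list \<Rightarrow> nat \<Rightarrow> bool" where
  "flow_value F k \<longleftrightarrow> flow F \<and> (\<forall>U. set S \<subseteq> U \<longrightarrow> U \<subseteq> set X \<longrightarrow> net U F = int k)"

definition cut :: "data set \<Rightarrow> data set" where
  "cut U = {a \<in> set A. head a \<in> U \<and> tail a \<notin> U}"

lemma augment_step_stationary: "found A X S F = [] \<Longrightarrow> augment_step A X S F = F"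
  by (simp add: augment_step_def)

text \<open>The path leads from a source to a vertex outside \<open>X\<close>, hence outside every
  admissible \<open>U\<close>; by \<open>walk_crossing\<close> it adds one to the net flow for all
  \<open>U\<close> at once.\<close>

lemma augment_step_value:
  assumes F: "flow_value F k" and "found A X S F \<noteq> []"
  shows "flow_value (augment_step A X S F) (Suc k)"
proof -
  define r where "r = head (list_data (found A X S F))"
  have "r \<in> set (found A X S F)" unfolding r_def using assms(2) by (cases "found A X S F") auto
  then have r: "r \<in> set (visited F S A)" "head r \<notin> set X" by (auto simp: found_def)
  let ?as = "items (tail r)"
  have w: "walk F (head r) ?as" "distinct ?as" using entries_visited[of F] r(1) by (auto simp: entries_def)
  have sub: "set ?as \<subseteq> set A" "set ?as \<inter> set F = {}" using walk_subset[OF w(1)] by auto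
  have fl: "flow F" using F by (simp add: flow_value_def)
  have "net U (fold augment ?as F) = int (Suc k)" if U: "set S \<subseteq> U" "U \<subseteq> set X" for U
  proof -
    have "head r \<notin> U" using r(2) U by auto
    then have "(\<Sum>a\<leftarrow>?as. crossing U a) = 1" using walk_crossing[OF w(1) U(1)] by simp
    moreover have "net U F = int k" using F U by (simp add: flow_value_def)
    ultimately show ?thesis using fold_augment_flow(2)[OF fl sub(1) w(2) sub(2), of U] by simp
  qed
  then show ?thesis
    unfolding flow_value_def augment_step_def r_def[symmetric]
    using fold_augment_flow(1)[OF fl sub(1) w(2) sub(2)] by blast
qed

text \<open>Weak duality: an arc counts at most \<open>1\<close> if it is in the cut and at most
  \<open>0\<close> otherwise.\<close>

lemma flow_value_le_cut:
  assumes F: "flow_value F k" and U: "set S \<subseteq> U" "U \<subseteq> set X"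
  shows "k \<le> card (cut U)"
proof -
  have sub: "set F \<subseteq> set A" using F by (auto simp: flow_value_def flow_def)
  have "int k = (\<Sum>a\<in>set F. crossing U a)" using F U by (auto simp: flow_value_def net_def)
  also have "\<dots> \<le> (\<Sum>a\<in>set F. of_bool (a \<in> cut U))"
    by (rule sum_mono) (use sub in \<open>auto simp: crossing_def cut_def\<close>)
  also have "\<dots> = int (card (set F \<inter> cut U))" by simp
  also have "\<dots> \<le> int (card (cut U))" by (simp add: card_mono cut_def)
  finally show ?thesis by simp
qed

text \<open>Take for \<open>U\<close> the vertices reachable in the residual network. An arc leaving
  \<open>U\<close> must carry flow, since otherwise its end would be reachable; so the flow fills
  the cut, and none of it returns.\<close>

lemma cut_of_maximal_flow:
  assumes F: "flow_value F k" and max: "found A X S F = []"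
  shows "\<exists>U. set S \<subseteq> U \<and> U \<subseteq> set X \<and> card (cut U) = k"
proof -
  define U where "U = head ` set (visited F S A)"
  have U: "U = (residual F)\<^sup>* `` set S" unfolding U_def by (rule heads_visited)
  have SU: "set S \<subseteq> U" unfolding U by auto
  have UX: "U \<subseteq> set X" using max by (auto simp: U_def found_def filter_empty_conv)
  have closed: "w \<in> U" if "u \<in> U" "Node u w \<in> set A" "Node u w \<notin> set F" for u w
  proof -
    have "(u, w) \<in> residual F" using that by (simp add: residual_def)
    then show ?thesis using that(1) unfolding U by (meson Image_iff rtrancl.rtrancl_into_rtrancl)
  qed
  have fl: "set F \<subseteq> set A" "\<And>a. a \<in> set F \<Longrightarrow> flip a \<notin> set F"
    using F by (auto simp: flow_value_def flow_def)
  have "crossing U a = of_bool (a \<in> cut U)" if "a \<in> set F" for a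
  proof -
    obtain u w where a: "a = Node u w" using arc[of a] subsetD[OF fl(1) \<open>a \<in> set F\<close>] by blast
    \<comment> \<open>An arc carrying flow into \<open>U\<close> ends in \<open>X\<close>, so its
      reverse exists; the reverse carries no flow, hence is residual and would put \<open>u\<close>
      into \<open>U\<close>.\<close>
    have "\<not> (u \<notin> U \<and> w \<in> U)"
    proof
      assume "u \<notin> U \<and> w \<in> U"
      then have "flip a \<in> set A" using flip_arc[of a] fl(1) that UX a by auto
      then show False using closed[of w u] fl(2)[OF that] \<open>u \<notin> U \<and> w \<in> U\<close> by (auto simp: a flip_def)
    qed
    then show ?thesis using that fl(1) by (auto simp: crossing_def cut_def a)
  qed
  then have "int k = (\<Sum>a\<in>set F. of_bool (a \<in> cut U))"
    using F SU UX by (auto simp: flow_value_def net_def)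
  also have "\<dots> = int (card (set F \<inter> cut U))" by simp
  also have "set F \<inter> cut U = cut U"
  proof -
    have "a \<in> set F" if "a \<in> cut U" for a
    proof -
      obtain u w where "a = Node u w" using arc[of a] \<open>a \<in> cut U\<close> by (auto simp: cut_def)
      then show ?thesis using closed[of u w] that by (auto simp: cut_def)
    qed
    then show ?thesis by blast
  qed
  finally have "card (cut U) = k" by simp
  then show ?thesis using SU UX by blast
qed

lemma max_flow_value:
  "\<exists>k\<le>length Bs. flow_value (max_flow A X S Bs) k \<and>
    (k = length Bs \<or> found A X S (max_flow A X S Bs) = [])"
proof (induction Bs rule: rev_induct)
  case Nil
  have "flow_value [] 0" by (simp add: flow_value_def flow_def net_def)
  then show ?case by (simp add: max_flow_def)
next
  case (snoc b Bs)
  let ?F = "max_flow A X S Bs"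
  obtain k where k: "k \<le> length Bs" "flow_value ?F k" "k = length Bs \<or> found A X S ?F = []"
    using snoc by blast
  have step: "max_flow A X S (Bs @ [b]) = augment_step A X S ?F" by (simp add: max_flow_def)
  show ?case
  proof (cases "found A X S ?F = []")
    case True
    then show ?thesis using k step augment_step_stationary by (intro exI[of _ k]) simp
  next
    case False
    then show ?thesis using k step augment_step_value[OF k(2) False] by (intro exI[of _ "Suc k"]) simp
  qed
qed

theorem no_augmenting_path_iff_cut:
  "found A X S (max_flow A X S Bs) = [] \<longleftrightarrow>
    (\<exists>U. set S \<subseteq> U \<and> U \<subseteq> set X \<and> card (cut U) \<le> length Bs)"
proof -
  let ?F = "max_flow A X S Bs"
  obtain k where k: "k \<le> length Bs" "flow_value ?F k" "k = length Bs \<or> found A X S ?F = []"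
    using max_flow_value by blast
  show ?thesis
  proof (cases "found A X S ?F = []")
    case True
    then show ?thesis using cut_of_maximal_flow[OF k(2)] k(1) by auto
  next
    case False
    \<comment> \<open>A path that remains after all rounds means that every round succeeded, so the
      value is \<open>length Bs\<close>; one more augmentation gives a flow too large for any cut
      with at most \<open>length Bs\<close> arcs.\<close>
    then have "length Bs < card (cut U)" if "set S \<subseteq> U" "U \<subseteq> set X" for U
      using flow_value_le_cut[OF augment_step_value[OF k(2) False] that] k(3) by simp
    then show ?thesis using False by (meson not_le)
  qed
qed

end

section \<open>Fire regions of bounded radius\<close>

definition reach :: "'v ugraph \<Rightarrow> 'v set \<Rightarrow> nat \<Rightarrow> 'v set" where
  "reach G V0 i = {y. \<exists>v\<in>V0. \<exists>k\<le>i. (adjacent G ^^ k) v y}"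

text \<open>Pairs directed outward, to match the arcs of the network; an edge with one end in
  \<open>U\<close> appears once.\<close>

definition boundary :: "'v ugraph \<Rightarrow> 'v set \<Rightarrow> ('v \<times> 'v) set" where
  "boundary G U = {(u, w). u \<in> U \<and> w \<notin> U \<and> adjacent G u w}"

lemma reach_0 [simp]: "reach G V0 0 = V0"
  by (auto simp: reach_def)

lemma reach_Suc: "reach G V0 (Suc i) = reach G V0 i \<union> {w. \<exists>u\<in>reach G V0 i. adjacent G u w}"
proof (intro equalityI subsetI)
  fix y assume "y \<in> reach G V0 (Suc i)"
  then obtain v k where v: "v \<in> V0" "k \<le> Suc i" "(adjacent G ^^ k) v y" by (auto simp: reach_def)
  show "y \<in> reach G V0 i \<union> {w. \<exists>u\<in>reach G V0 i. adjacent G u w}"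
  proof (cases k)
    case 0
    then have "v = y" using v(3) by simp
    moreover have "(adjacent G ^^ 0) y y" by simp
    ultimately show ?thesis using v(1) unfolding reach_def by blast
  next
    case (Suc j)
    then obtain u where "(adjacent G ^^ j) v u" "adjacent G u y" using v(3) by auto
    moreover have "j \<le> i" using v(2) Suc by simp
    ultimately have "u \<in> reach G V0 i" using v(1) unfolding reach_def by blast
    then show ?thesis using \<open>adjacent G u y\<close> by blast
  qed
next
  fix y assume "y \<in> reach G V0 i \<union> {w. \<exists>u\<in>reach G V0 i. adjacent G u w}"
  then consider "y \<in> reach G V0 i" | u where "u \<in> reach G V0 i" "adjacent G u y" by blast
  then show "y \<in> reach G V0 (Suc i)"
  proof cases
    case 1
    then show ?thesis by (auto simp: reach_def intro: le_SucI)
  next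
    case 2
    then obtain v k where "v \<in> V0" "k \<le> i" "(adjacent G ^^ k) v u" by (auto simp: reach_def)
    then have "(adjacent G ^^ Suc k) v y" using 2 by auto
    then show ?thesis using \<open>v \<in> V0\<close> \<open>k \<le> i\<close> unfolding reach_def
      by (metis (mono_tags, lifting) Suc_le_mono mem_Collect_eq)
  qed
qed

lemma relpow_imp_relpowp:
  fixes R :: "('a \<times> 'a) set" and P :: "'a \<Rightarrow> 'a \<Rightarrow> bool"
  shows "(x, y) \<in> R ^^ k \<Longrightarrow> (\<And>a b. (a, b) \<in> R \<Longrightarrow> P a b) \<Longrightarrow> (P ^^ k) x y"
  by (induction k arbitrary: y) auto

lemma adjacent_sym: "adjacent G u w \<longleftrightarrow> adjacent G w u"
  by (simp add: adjacent_def insert_commute)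

text \<open>Expansion appears in contrapositive form: few escaping edges force few vertices.
  \<open>nbs\<close> is the function on names that the neighbour program computes.\<close>

locale firebreak_graph =
  fixes G :: "'v ugraph" and \<Delta> :: nat and name :: "'v \<Rightarrow> data" and nbs :: "data \<Rightarrow> data"
    and growth_poly name_poly expansion_poly :: "nat poly"
  assumes simple: "simple_graph G"
    and finite_neighbours: "v \<in> verts G \<Longrightarrow> finite (neighbours G v)"
    and card_neighbours: "v \<in> verts G \<Longrightarrow> card (neighbours G v) \<le> \<Delta>"
    and inj_name: "inj_on name (verts G)"
    and nbs: "v \<in> verts G \<Longrightarrow> set (items (nbs (name v))) = name ` neighbours G v"
    and ptime_nbs: "ptime (name ` verts G) nbs"
    and finite_ball: "v \<in> verts G \<Longrightarrow> finite (graph_ball G v K)"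
    and card_ball: "v \<in> verts G \<Longrightarrow> card (graph_ball G v K) \<le> poly growth_poly K"
    and name_size: "u \<in> verts G \<Longrightarrow> v \<in> verts G \<Longrightarrow>
      dsize (name v) \<le> poly name_poly (dsize (name u) + graph_dist G u v)"
    and expansion: "U \<subseteq> verts G \<Longrightarrow> finite U \<Longrightarrow> card (escaping_edges G U) \<le> k \<Longrightarrow>
      card U \<le> poly expansion_poly k"
begin

lemma adjacentD:
  assumes "adjacent G u w"
  shows "u \<in> verts G" "w \<in> verts G" "u \<noteq> w"
proof -
  have "{u, w} \<subseteq> verts G" "card {u, w} = 2"
    using assms simple by (auto simp: adjacent_def simple_graph_def)
  then show "u \<in> verts G" "w \<in> verts G" "u \<noteq> w" by (auto simp: card_insert_if)
qed

abbreviation remove :: "'v set \<Rightarrow> 'v ugraph" where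
  "remove V' \<equiv> induced G (verts G - V')"

lemma adjacent_remove: "adjacent (remove V') u w \<longleftrightarrow> adjacent G u w \<and> u \<notin> V' \<and> w \<notin> V'"
  using adjacentD[of u w] by (auto simp: adjacent_def induced_def)

lemma verts_remove: "verts (remove V') = verts G - V'"
  by (auto simp: induced_def)

lemma reach_subset_verts: "V0 \<subseteq> verts G - V' \<Longrightarrow> reach (remove V') V0 i \<subseteq> verts G - V'"
  by (induction i) (auto simp: reach_Suc adjacent_remove dest: adjacentD)

text \<open>A path that avoids \<open>V'\<close> is a path of \<open>G\<close>, so distances in
  \<open>G\<close> are no longer. In this way growth and name lengths, known for \<open>G\<close>,
  carry over to the graph without \<open>V'\<close>.\<close>

lemma reach_dist:
  assumes "y \<in> reach (remove V') V0 i" "V0 \<subseteq> verts G - V'"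
  obtains v where "v \<in> V0" "y \<in> graph_ball G v i" "graph_dist G v y \<le> i"
proof -
  obtain v k where v: "v \<in> V0" "k \<le> i" "(adjacent (remove V') ^^ k) v y"
    using assms(1) by (auto simp: reach_def)
  have p: "(adjacent G ^^ k) v y"
    by (rule relpowp_mono[OF _ v(3)]) (auto simp: adjacent_remove)
  then have d: "graph_dist G v y \<le> i"
    unfolding graph_dist_def using v(2) Least_le le_trans by metis
  have "y \<in> verts G" using reach_subset_verts[OF assms(2)] assms(1) by blast
  then have "y \<in> component_of G v" using relpowp_imp_rtranclp[OF p] by (simp add: component_of_def)
  then show thesis using that v(1) d by (simp add: graph_ball_def)
qed

lemma reach_subset_balls:
  assumes "V0 \<subseteq> verts G - V'"
  shows "reach (remove V') V0 i \<subseteq> (\<Union>v\<in>V0. graph_ball G v i)"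
  using reach_dist[OF _ assms] by blast

lemma finite_reach:
  assumes "V0 \<subseteq> verts G - V'" "finite V0"
  shows "finite (reach (remove V') V0 i)"
  using reach_subset_balls[OF assms(1)] by (rule finite_subset) (use assms finite_ball in auto)

lemma card_reach:
  assumes "V0 \<subseteq> verts G - V'" "finite V0"
  shows "card (reach (remove V') V0 i) \<le> card V0 * poly growth_poly i"
proof -
  have "card (reach (remove V') V0 i) \<le> card (\<Union>v\<in>V0. graph_ball G v i)"
    using reach_subset_balls[OF assms(1)] by (rule card_mono[rotated]) (use assms finite_ball in auto)
  also have "\<dots> \<le> (\<Sum>v\<in>V0. card (graph_ball G v i))" by (rule card_UN_le[OF assms(2)])
  also have "\<dots> \<le> (\<Sum>v\<in>V0. poly growth_poly i)"
    using assms(1) card_ball by (intro sum_mono) auto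
  finally show ?thesis by simp
qed

lemma finite_boundary:
  assumes "finite U" "U \<subseteq> verts G"
  shows "finite (boundary (remove V') U)"
proof (rule finite_subset)
  show "boundary (remove V') U \<subseteq> Sigma U (neighbours G)"
    by (auto simp: boundary_def adjacent_remove neighbours_def)
  show "finite (Sigma U (neighbours G))" using assms finite_neighbours by (intro finite_SigmaI) auto
qed

text \<open>The boundary edges themselves form a firebreak: after their deletion no component of a
  burning vertex can leave the finite set \<open>U\<close>.\<close>

lemma firebreak_if_cut:
  assumes U: "V0 \<subseteq> U" "U \<subseteq> verts G" "finite U" and B: "card (boundary (remove V') U) \<le> B"
  shows "firebreak_yes (remove V', V0, B)"
proof -
  define H where "H = (\<lambda>(u, w). {u, w}) ` boundary (remove V') U"
  have fin: "finite (boundary (remove V') U)" by (rule finite_boundary[OF U(3,2)])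
  have "card H \<le> B" unfolding H_def using card_image_le[OF fin] B le_trans by blast
  moreover have "H \<subseteq> edges (remove V')" by (auto simp: H_def boundary_def adjacent_def)
  moreover have "finite H" using fin by (simp add: H_def)
  moreover have "finite (component_of (delete_edges (remove V') H) v)" if v: "v \<in> V0" for v
  proof (rule finite_subset[OF _ U(3)])
    have "y \<in> U" if "(adjacent (delete_edges (remove V') H))\<^sup>*\<^sup>* v y" for y
      using that
    proof (induction rule: rtranclp_induct)
      case base
      then show ?case using v U(1) by blast
    next
      case (step y z)
      then have "{y, z} \<notin> H" "adjacent (remove V') y z"
        by (auto simp: adjacent_def delete_edges_def)
      then show ?case using step.IH by (force simp: H_def boundary_def)
    qed
    then show "component_of (delete_edges (remove V') H) v \<subseteq> U" by (auto simp: component_of_def)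
  qed
  ultimately show ?thesis unfolding firebreak_yes_def by blast
qed

text \<open>An edge escaping from the burnt region \<open>U\<close> belongs to the firebreak or meets \<open>V'\<close>, so
  the expansion property bounds \<open>card U\<close>, and thereby the radius of \<open>U\<close>.\<close>

lemma cut_if_firebreak:
  assumes V': "finite V'" "V' \<subseteq> verts G" and V0: "V0 \<subseteq> verts G - V'" "finite V0"
    and yes: "firebreak_yes (remove V', V0, B)"
    and N: "poly expansion_poly (B + \<Delta> * card V') * poly expansion_poly (B + \<Delta> * card V') \<le> N"
  shows "\<exists>U. V0 \<subseteq> U \<and> U \<subseteq> reach (remove V') V0 N \<and> card (boundary (remove V') U) \<le> B"
proof -
  obtain H where H: "H \<subseteq> edges (remove V')" "finite H" "card H \<le> B"
    "\<And>v. v \<in> V0 \<Longrightarrow> finite (component_of (delete_edges (remove V') H) v)"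
    using yes unfolding firebreak_yes_def by auto
  define D where "D = delete_edges (remove V') H"
  define U where "U = (\<Union>v\<in>V0. component_of D v)"
  have adjD: "adjacent D u w \<longleftrightarrow> adjacent (remove V') u w \<and> {u, w} \<notin> H" for u w
    by (auto simp: D_def adjacent_def delete_edges_def)
  have vertsD: "verts D = verts G - V'" by (simp add: D_def delete_edges_def verts_remove)
  have finU: "finite U" unfolding U_def D_def using V0(2) H(4) by blast
  have UV: "U \<subseteq> verts G - V'" by (auto simp: U_def component_of_def vertsD)
  have SU: "V0 \<subseteq> U" using V0(1) by (auto simp: U_def component_of_def vertsD)
  have closed: "w \<in> U" if "u \<in> U" "adjacent D u w" for u w
  proof -
    have "w \<in> verts D"
      using that(2) adjacentD(2)[of u w] by (auto simp: adjD adjacent_remove vertsD)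
    then show ?thesis using that unfolding U_def component_of_def
      by (auto intro: rtranclp.rtrancl_into_rtrancl)
  qed
  have "card (boundary (remove V') U) \<le> card H"
  proof (rule card_inj_on_le[OF _ _ H(2)])
    \<comment> \<open>The order of a pair is recovered from its edge, because exactly one end lies
      in \<open>U\<close>.\<close>
    show "inj_on (\<lambda>(u, w). {u, w}) (boundary (remove V') U)"
      by (auto simp: inj_on_def boundary_def doubleton_eq_iff)
    show "(\<lambda>(u, w). {u, w}) ` boundary (remove V') U \<subseteq> H"
      using closed by (auto simp: boundary_def adjD)
  qed
  then have bnd: "card (boundary (remove V') U) \<le> B" using H(3) by simp
  \<comment> \<open>Edges at \<open>V'\<close> are absent from the instance, so no firebreak
    contains them, yet they may count as escaping in \<open>G\<close>; they cost at most
    \<open>\<Delta>\<close> for each vertex of \<open>V'\<close>.\<close>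
  let ?E = "(\<lambda>(u, w). {u, w}) ` Sigma V' (neighbours G)"
  have finS: "finite (Sigma V' (neighbours G))" using V' finite_neighbours by (intro finite_SigmaI) auto
  have "card ?E \<le> card (Sigma V' (neighbours G))" by (rule card_image_le[OF finS])
  also have "\<dots> = (\<Sum>v\<in>V'. card (neighbours G v))"
    using V' finite_neighbours by (intro card_SigmaI) auto
  also have "\<dots> \<le> (\<Sum>v\<in>V'. \<Delta>)" using V' card_neighbours by (intro sum_mono) auto
  finally have cardE: "card ?E \<le> \<Delta> * card V'" by (simp add: mult.commute)
  have "escaping_edges G U \<subseteq> H \<union> ?E"
  proof
    fix e assume "e \<in> escaping_edges G U"
    then obtain u w where e: "e = {u, w}" "{u, w} \<in> edges G" "u \<in> U" "w \<notin> U"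
      by (auto simp: escaping_edges_def)
    show "e \<in> H \<union> ?E"
    proof (cases "w \<in> V'")
      case True
      then have "(w, u) \<in> Sigma V' (neighbours G)" "e = {w, u}"
        using e by (auto simp: neighbours_def adjacent_def insert_commute)
      then show ?thesis by force
    next
      case False
      then have "adjacent (remove V') u w" using e UV unfolding adjacent_remove by (auto simp: adjacent_def)
      then show ?thesis using closed[OF e(3), of w] e by (auto simp: adjD)
    qed
  qed
  then have "card (escaping_edges G U) \<le> card (H \<union> ?E)" using H(2) finS by (intro card_mono) auto
  also have "\<dots> \<le> B + \<Delta> * card V'" using card_Un_le[of H ?E] cardE H(3) by simp
  finally have cardU: "card U \<le> poly expansion_poly (B + \<Delta> * card V')"
    using expansion[of U] UV finU by blast
  have "y \<in> reach (remove V') V0 N" if y: "y \<in> U" for y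
  proof -
    obtain v where v: "v \<in> V0" "(adjacent D)\<^sup>*\<^sup>* v y" using y by (auto simp: U_def component_of_def)
    \<comment> \<open>Restricted to \<open>U\<close>, the relation has at most
      \<open>card U * card U\<close> pairs, and the number of pairs bounds the length of some path
      to \<open>y\<close>. This is the origin of the square in the hypothesis on
      \<open>N\<close>.\<close>
    define R where "R = {(a, b). a \<in> U \<and> b \<in> U \<and> adjacent D a b}"
    have "(v, y) \<in> R\<^sup>* \<and> y \<in> U" using v(2)
    proof (induction rule: rtranclp_induct)
      case base
      then show ?case using v(1) SU by auto
    next
      case (step y z)
      then have "(y, z) \<in> R" using closed by (auto simp: R_def)
      then show ?case using step.IH by (auto simp: R_def intro: rtrancl.rtrancl_into_rtrancl)
    qed
    moreover have RU: "R \<subseteq> U \<times> U" by (auto simp: R_def)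
    moreover have "finite R" using RU finU finite_subset by blast
    ultimately obtain k where k: "k \<le> card R" "(v, y) \<in> R ^^ k"
      using rtrancl_finite_eq_relpow[of R] by auto
    have "card R \<le> card U * card U"
      using card_mono[OF _ RU] finU by (simp add: card_cartesian_product)
    then have "k \<le> N" using k(1) cardU N by (meson le_trans mult_le_mono)
    moreover have "(adjacent (remove V') ^^ k) v y"
      by (rule relpow_imp_relpowp[OF k(2)]) (auto simp: R_def adjD)
    ultimately show ?thesis using v(1) by (auto simp: reach_def)
  qed
  then show ?thesis using SU bnd by blast
qed


section \<open>The algorithm\<close>

definition instances :: "data set" where
  "instances = {list_data [c, list_data (map name xs), list_data (map name ys), nat_data B] |c xs ys B.
     distinct xs \<and> distinct ys \<and> set xs \<subseteq> verts G \<and> set ys \<subseteq> verts G - set xs}"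

definition removed :: "data \<Rightarrow> data list" where
  "removed x = items (head (tail x))"

definition burning :: "data \<Rightarrow> data list" where
  "burning x = items (head (tail (tail x)))"

definition budget :: "data \<Rightarrow> data list" where
  "budget x = items (head (tail (tail (tail x))))"

text \<open>With \<open>k = B + card V'\<close> one has
  \<open>B + \<Delta> * card V' \<le> (\<Delta> + 1) * k\<close>, so this polynomial in the single
  number \<open>k\<close> dominates the squared expansion bound. The number \<open>k\<close> is
  available in unary as a list length.\<close>

definition radius :: "nat \<Rightarrow> nat" where
  "radius k = poly ((pcompose expansion_poly [:0, \<Delta> + 1:])\<^sup>2) k"

definition rounds :: "data \<Rightarrow> data list" where
  "rounds x = replicate (radius (length (budget x @ removed x))) Leaf"

text \<open>\<open>List.insert\<close> prevents repetitions, which could make the list grow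
  exponentially with the rounds even though few vertices are reached.\<close>

definition expand :: "data list \<Rightarrow> data list \<Rightarrow> data list" where
  "expand Vs X = fold List.insert
     (filter (\<lambda>w. \<not> w \<in> set Vs) (concat (map (\<lambda>u. items (nbs u)) X))) X"

definition region :: "data \<Rightarrow> data list" where
  "region x = fold (\<lambda>_. expand (removed x)) (rounds x) (burning x)"

text \<open>An edge inside the region yields two opposite arcs, an edge that leaves it only the
  outward one.\<close>

definition arcs :: "data \<Rightarrow> data list" where
  "arcs x = concat (map (\<lambda>u. map (Node u)
     (filter (\<lambda>w. \<not> w \<in> set (removed x)) (items (nbs u)))) (region x))"

lemma set_expand: "set (expand Vs X) = set X \<union> ((\<Union>u\<in>set X. set (items (nbs u))) - set Vs)"
proof -
  have "set (fold List.insert ys zs) = set zs \<union> set ys" for ys zs :: "data list"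
    by (induction ys arbitrary: zs) auto
  then show ?thesis by (auto simp: expand_def)
qed

lemma distinct_expand: "distinct X \<Longrightarrow> distinct (expand Vs X)"
proof -
  have "distinct zs \<Longrightarrow> distinct (fold List.insert ys zs)" for ys zs :: "data list"
    by (induction ys arbitrary: zs) auto
  then show "distinct X \<Longrightarrow> distinct (expand Vs X)" by (auto simp: expand_def)
qed

lemma nbs_remove:
  assumes "u \<in> verts G - V'" "V' \<subseteq> verts G"
  shows "set (items (nbs (name u))) - name ` V' = name ` {w. adjacent (remove V') u w}"
proof -
  have "name w \<in> name ` V' \<longleftrightarrow> w \<in> V'" if "adjacent G u w" for w
    using inj_on_image_mem_iff[OF inj_name adjacentD(2)[OF that] assms(2)] .
  then show ?thesis using assms(1) by (auto simp: nbs neighbours_def adjacent_remove)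
qed

lemma fold_expand:
  assumes "set X = name ` V0" "distinct X" "set Vs = name ` V'" "V0 \<subseteq> verts G - V'" "V' \<subseteq> verts G"
  shows "distinct (fold (\<lambda>_. expand Vs) us X) \<and>
    set (fold (\<lambda>_. expand Vs) us X) = name ` reach (remove V') V0 (length (us :: data list))"
proof (induction us rule: rev_induct)
  case Nil
  then show ?case using assms by simp
next
  case (snoc b us)
  let ?R = "reach (remove V') V0 (length us)"
  let ?Y = "fold (\<lambda>_. expand Vs) us X"
  have R: "?R \<subseteq> verts G - V'" by (rule reach_subset_verts[OF assms(4)])
  have Y: "set ?Y = name ` ?R" "distinct ?Y" using snoc by auto
  have "(\<Union>u\<in>set ?Y. set (items (nbs u))) - set Vs =
      (\<Union>u\<in>?R. set (items (nbs (name u))) - name ` V')"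
    unfolding Y(1) assms(3) by blast
  also have "\<dots> = (\<Union>u\<in>?R. name ` {w. adjacent (remove V') u w})"
    using nbs_remove[OF _ assms(5)] R by (intro SUP_cong) auto
  also have "\<dots> = name ` {w. \<exists>u\<in>?R. adjacent (remove V') u w}" by blast
  finally have "set (expand Vs ?Y) = name ` reach (remove V') V0 (Suc (length us))"
    unfolding set_expand Y(1) reach_Suc image_Un by simp
  then show ?case using distinct_expand[OF Y(2)] by simp
qed

section \<open>Polynomial time for the region and its arcs\<close>

lemma ptime_fold_insert:
  assumes "ptime D (\<lambda>x. list_data (a x))" "ptime D (\<lambda>x. list_data (b x))"
  shows "ptime D (\<lambda>x. list_data (fold List.insert (a x) (b x)))"
proof -
  let ?g = "\<lambda>_ a acc. list_data (List.insert a (items acc))"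
  have fold: "fold (?g z) us d = list_data (fold List.insert us (items d))" for z :: data and us d
    using fold_list_data[of "?g z" List.insert us "items d"] by simp
  have size: "dsize (list_data (fold List.insert us F)) \<le> dsize (list_data F) + dsize (list_data us)"
    for us F
  proof (induction us arbitrary: F)
    case (Cons a us)
    have "dsize (list_data (List.insert a F)) \<le> dsize (list_data F) + Suc (dsize a)"
      by (auto simp: List.insert_def)
    then show ?case using Cons[of "List.insert a F"] by simp
  qed simp
  have "ptime UNIV (\<lambda>z. fold (?g z) (items (head z)) (tail z))"
  proof (rule ptime_fold[where E = UNIV and b = "\<lambda>n. n + n"])
    show "ptime UNIV (\<lambda>z. ?g (head z) (head (tail z)) (tail (tail z)))"
      unfolding List.insert_def by (intro ptime_intros)
    fix z us vs assume "items (head z) = us @ vs"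
    then have "dsize (list_data us) \<le> dsize (list_data (items (head z)))"
      by (simp add: dsize_list_data del: list_data_items)
    then have "dsize (list_data us) \<le> dsize z" using dsize_head_le[of z] by simp
    then show "dsize (fold (?g z) us (tail z)) \<le> dsize z + dsize z"
      unfolding fold using size[of us "items (tail z)"] dsize_tail_le[of z] by simp
  qed (intro ptime_intros poly_bounded_intros UNIV_I)+
  then have "ptime UNIV (\<lambda>z. list_data (fold List.insert (items (head z)) (items (tail z))))"
    unfolding fold .
  from ptime_comp_UNIV[OF ptime_Node[OF assms] this] show ?thesis by simp
qed

lemma ptime_nbs_tail: "ptime {Node z u |z u. u \<in> name ` verts G} (\<lambda>z. list_data (items (nbs (tail z))))"
  by (intro ptime_items ptime_comp[OF ptime_tail0 ptime_nbs]) auto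

text \<open>The neighbour program is known to halt only on vertex names, which forces this domain;
  \<open>fold_expand\<close> keeps every intermediate region inside it.\<close>

lemma ptime_expand:
  "ptime {z. set (items (tail z)) \<subseteq> name ` verts G}
     (\<lambda>z. list_data (expand (items (head z)) (items (tail z))))"
  unfolding expand_def
  by (intro ptime_fold_insert ptime_filter_UNIV ptime_intros
      ptime_concat_map[OF _ ptime_nbs_tail]) auto

lemma ptime_rounds: "ptime D (\<lambda>x. list_data (rounds x))"
proof -
  have "ptime D (\<lambda>x. list_data (map (\<lambda>_. Leaf) (budget x @ removed x)))"
    unfolding budget_def removed_def by (intro ptime_intros ptime_Leaf)
  then have "ptime D (\<lambda>x. list_data (replicate (length (budget x @ removed x)) Leaf))"
    by (simp only: map_replicate_const)
  then show ?thesis unfolding rounds_def radius_def by (rule ptime_replicate_poly)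
qed

lemma instancesE:
  assumes "x \<in> instances"
  obtains V' V0 where "finite V'" "V' \<subseteq> verts G" "finite V0" "V0 \<subseteq> verts G - V'"
    "set (removed x) = name ` V'" "set (burning x) = name ` V0" "distinct (burning x)"
    "length (removed x) = card V'" "card V0 \<le> dsize x" "\<And>v. v \<in> V0 \<Longrightarrow> dsize (name v) \<le> dsize x"
    "length (budget x @ removed x) \<le> dsize x"
proof -
  obtain c xs ys B where x: "x = list_data [c, list_data (map name xs), list_data (map name ys), nat_data B]"
    and d: "distinct xs" "distinct ys" and s: "set xs \<subseteq> verts G" "set ys \<subseteq> verts G - set xs"
    using assms unfolding instances_def by blast
  have v: "removed x = map name xs" "burning x = map name ys" "budget x = replicate B Leaf"
    by (simp_all add: x removed_def burning_def budget_def nat_data_def)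
  have "inj_on name (set ys)" using inj_name s by (meson Diff_subset inj_on_subset subset_trans)
  then have dy: "distinct (map name ys)" using d by (simp add: distinct_map)
  have sz: "dsize (name w) \<le> dsize x" if "w \<in> set ys" for w
    using dsize_mem_list_data[of "name w" "map name ys"] that by (simp add: x)
  have len: "length (budget x @ removed x) \<le> dsize x"
    using length_le_dsize[of "map name xs"] length_le_dsize[of "replicate B Leaf"]
    unfolding v by (simp add: x nat_data_def)
  have leny: "card (set ys) \<le> dsize x"
    using length_le_dsize[of "map name ys"] distinct_card[OF d(2)] by (simp add: x)
  show thesis
    by (rule that[of "set xs" "set ys"]) (use s v dy sz len leny distinct_card[OF d(1)] in auto)
qed

lemma ptime_region: "ptime instances (\<lambda>x. list_data (region x))"
proof -
  let ?g = "\<lambda>x _ acc. list_data (expand (removed x) (items acc))"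
  let ?E = "{Node x (Node h acc) |x h acc. set (items acc) \<subseteq> name ` verts G}"
  let ?r = "(pcompose expansion_poly [:0, \<Delta> + 1:])\<^sup>2"
  \<comment> \<open>At most \<open>n\<close> burning vertices, each with a ball of radius
    \<open>poly ?r n\<close>, bound the number of names; the last factor bounds the length of a name
    within that distance.\<close>
  let ?b = "\<lambda>n. Suc ((n * poly growth_poly (poly ?r n)) * Suc (poly name_poly (n + poly ?r n)))"
  have fold: "fold (?g x) us (list_data X) = list_data (fold (\<lambda>_. expand (removed x)) us X)"
    for x and us X :: "data list"
    by (rule fold_list_data) simp
  have "ptime instances (\<lambda>x. fold (?g x) (rounds x) (list_data (burning x)))"
  proof (rule ptime_fold[where E = ?E and b = ?b])
    show "ptime instances (\<lambda>x. list_data (rounds x))" by (rule ptime_rounds)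
    show "ptime instances (\<lambda>x. list_data (burning x))"
      unfolding burning_def by (intro ptime_intros)
    have "ptime ?E (\<lambda>z. Node (head (tail (head z))) (tail (tail z)))" by (intro ptime_intros)
    then have "ptime ?E (\<lambda>z. list_data (expand (items (head (Node (head (tail (head z))) (tail (tail z)))))
        (items (tail (Node (head (tail (head z))) (tail (tail z)))))))"
      by (rule ptime_comp[OF _ ptime_expand]) auto
    then show "ptime ?E (\<lambda>z. ?g (head z) (head (tail z)) (tail (tail z)))"
      by (simp add: removed_def)
    show "poly_bounded ?b" by (intro poly_bounded_intros)
  next
    fix x us h vs assume x: "x \<in> instances" and "rounds x = us @ h # vs"
    obtain V' V0 where V: "V' \<subseteq> verts G" "V0 \<subseteq> verts G - V'"
      "set (removed x) = name ` V'" "set (burning x) = name ` V0" "distinct (burning x)"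
      using instancesE[OF x] by metis
    have "set (fold (\<lambda>_. expand (removed x)) us (burning x)) \<subseteq> name ` verts G"
      using fold_expand[OF V(4,5,3,2,1), of us] reach_subset_verts[OF V(2)] by blast
    then show "Node x (Node h (fold (?g x) us (list_data (burning x)))) \<in> ?E"
      unfolding fold by simp
  next
    fix x us vs assume x: "x \<in> instances" and us: "rounds x = us @ vs"
    obtain V' V0 where V: "V' \<subseteq> verts G" "V0 \<subseteq> verts G - V'" "finite V0"
      "set (removed x) = name ` V'" "set (burning x) = name ` V0" "distinct (burning x)"
      and sz: "card V0 \<le> dsize x" "\<And>v. v \<in> V0 \<Longrightarrow> dsize (name v) \<le> dsize x"
        "length (budget x @ removed x) \<le> dsize x"
      using instancesE[OF x] by metis
    let ?n = "dsize x"
    let ?X = "fold (\<lambda>_. expand (removed x)) us (burning x)"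
    let ?R = "reach (remove V') V0 (length us)"
    have X: "distinct ?X" "set ?X = name ` ?R" using fold_expand[OF V(5,6,4,2,1), of us] by auto
    have "length us \<le> length (rounds x)" using us by simp
    also have "\<dots> \<le> poly ?r ?n"
      unfolding rounds_def radius_def length_replicate by (rule poly_nat_mono[OF sz(3)])
    finally have len: "length us \<le> poly ?r ?n" .
    have "length ?X = card (name ` ?R)" using distinct_card[OF X(1)] X(2) by simp
    also have "\<dots> \<le> card ?R" by (rule card_image_le[OF finite_reach[OF V(2,3)]])
    also have "\<dots> \<le> card V0 * poly growth_poly (length us)" by (rule card_reach[OF V(2,3)])
    also have "\<dots> \<le> ?n * poly growth_poly (poly ?r ?n)"
      by (rule mult_le_mono[OF sz(1) poly_nat_mono[OF len]])
    finally have lenX: "length ?X \<le> ?n * poly growth_poly (poly ?r ?n)" .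
    have "dsize (list_data ?X) \<le> Suc (length ?X * Suc (poly name_poly (?n + poly ?r ?n)))"
    proof (rule dsize_list_data_le)
      fix d assume "d \<in> set ?X"
      then obtain y where y: "d = name y" "y \<in> ?R" unfolding X(2) by blast
      obtain v where v: "v \<in> V0" "graph_dist G v y \<le> length us" using reach_dist[OF y(2) V(2)] by metis
      have "dsize (name y) \<le> poly name_poly (dsize (name v) + graph_dist G v y)"
        using name_size[of v y] v(1) V(2) y(2) reach_subset_verts[OF V(2)] by blast
      also have "\<dots> \<le> poly name_poly (?n + poly ?r ?n)"
        by (rule poly_nat_mono) (use sz(2)[OF v(1)] v(2) len in simp)
      finally show "dsize d \<le> poly name_poly (?n + poly ?r ?n)" by (simp add: y(1))
    qed
    also have "\<dots> \<le> ?b ?n" using lenX by (meson Suc_le_mono mult_le_mono1)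
    finally show "dsize (fold (?g x) us (list_data (burning x))) \<le> ?b ?n" unfolding fold .
  qed
  then show ?thesis unfolding fold region_def .
qed

lemma ptime_arcs: "ptime instances (\<lambda>x. list_data (arcs x))"
proof -
  let ?E = "{Node z u |z u. u \<in> name ` verts G}"
  have "ptime ?E (\<lambda>z. list_data (map (Node (tail z))
      (filter (\<lambda>w. \<not> w \<in> set (removed (head z))) (items (nbs (tail z))))))"
    unfolding removed_def by (intro ptime_map_UNIV ptime_filter_UNIV ptime_nbs_tail ptime_intros)
  then show ?thesis
    unfolding arcs_def
  proof (rule ptime_concat_map[OF ptime_region])
    fix x u assume x: "x \<in> instances" and u: "u \<in> set (region x)"
    obtain V' V0 where V: "V' \<subseteq> verts G" "V0 \<subseteq> verts G - V'"
      "set (removed x) = name ` V'" "set (burning x) = name ` V0" "distinct (burning x)"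
      using instancesE[OF x] by metis
    then show "Node x u \<in> ?E"
      using u fold_expand[OF V(4,5,3,2,1), of "rounds x"] reach_subset_verts[OF V(2)]
      unfolding region_def by blast
  qed
qed

section \<open>The decision procedure and its correctness\<close>

definition decide :: "data \<Rightarrow> bool" where
  "decide x \<longleftrightarrow> found (arcs x) (region x) (burning x)
     (max_flow (arcs x) (region x) (burning x) (budget x)) = []"

lemma ptime_decide: "ptime instances (\<lambda>x. bool_data (decide x))"
  unfolding decide_def
proof (rule ptime_no_augmenting_path[OF ptime_arcs ptime_region])
  show "ptime instances (\<lambda>x. list_data (burning x))" "ptime instances (\<lambda>x. list_data (budget x))"
    unfolding burning_def budget_def by (intro ptime_intros)+
qed

text \<open>On names, the flow theorem decides whether some set between the burning vertices and the
  region has at most \<open>B\<close> outgoing arcs. Injectivity of \<open>name\<close> turns this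
  into a statement about vertex sets with small boundary, which \<open>firebreak_if_cut\<close> and
  \<open>cut_if_firebreak\<close> equate with the existence of a firebreak.\<close>

lemma decide_correct:
  assumes x: "x = list_data [c, list_data (map name xs), list_data (map name ys), nat_data B]"
    and V: "distinct xs" "distinct ys" "set xs \<subseteq> verts G" "set ys \<subseteq> verts G - set xs"
  shows "decide x \<longleftrightarrow> firebreak_yes (remove (set xs), set ys, B)"
proof -
  let ?V' = "set xs" and ?V0 = "set ys"
  let ?H = "remove ?V'"
  define N where "N = length (rounds x)"
  define R where "R = reach ?H ?V0 N"
  let ?\<phi> = "\<lambda>(u, w). Node (name u) (name w)"
  have v: "removed x = map name xs" "burning x = map name ys" "budget x = replicate B Leaf"
    by (simp_all add: x removed_def burning_def budget_def nat_data_def)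
  have N: "N = radius (B + card ?V')" by (simp add: N_def rounds_def v distinct_card[OF V(1)])
  have RV: "R \<subseteq> verts G - ?V'" unfolding R_def by (rule reach_subset_verts[OF V(4)])
  have "distinct (burning x)"
    using V inj_name by (auto simp: v distinct_map intro: inj_on_subset)
  then have X: "set (region x) = name ` R"
    unfolding region_def R_def N_def using V by (intro conjunct2[OF fold_expand]) (auto simp: v)
  have inj: "name u = name w \<longleftrightarrow> u = w" if "u \<in> verts G" "w \<in> verts G" for u w
    using inj_name that by (auto simp: inj_on_def)
  have A: "set (arcs x) = ?\<phi> ` {(u, w). u \<in> R \<and> adjacent ?H u w}"
  proof -
    have "set (arcs x) = (\<Union>u\<in>R. Node (name u) ` (set (items (nbs (name u))) - name ` ?V'))"
      by (auto simp: arcs_def X v)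
    also have "\<dots> = (\<Union>u\<in>R. Node (name u) ` name ` {w. adjacent ?H u w})"
    proof (intro SUP_cong refl)
      fix u assume "u \<in> R"
      then have "u \<in> verts G - ?V'" using RV by blast
      then show "Node (name u) ` (set (items (nbs (name u))) - name ` ?V') =
          Node (name u) ` name ` {w. adjacent ?H u w}"
        using nbs_remove[OF _ V(3)] by simp
    qed
    also have "\<dots> = ?\<phi> ` {(u, w). u \<in> R \<and> adjacent ?H u w}" by auto
    finally show ?thesis .
  qed
  have adjV: "u \<in> verts G" "w \<in> verts G" "u \<noteq> w" if "adjacent ?H u w" for u w
    using that adjacentD by (auto simp: adjacent_remove)
  interpret network "arcs x" "region x" "burning x"
  proof
    fix a assume "a \<in> set (arcs x)"
    then obtain u w where a: "a = Node (name u) (name w)" "u \<in> R" "adjacent ?H u w"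
      unfolding A by auto
    then show "\<exists>u w. a = Node u w \<and> u \<noteq> w \<and> u \<in> set (region x)"
      using inj adjV by (auto simp: X)
    assume "tail a \<in> set (region x)"
    \<comment> \<open>By injectivity of \<open>name\<close>, an arc that ends in the region ends in
      a vertex of \<open>R\<close>, so the reversed arc is listed from there.\<close>
    then have "w \<in> R"
      using a(1) RV inj_on_image_mem_iff[OF inj_name adjV(2)[OF a(3)], of R] by (auto simp: X)
    moreover have "adjacent ?H w u" using a(3) adjacent_sym by metis
    ultimately have "(w, u) \<in> {(u, w). u \<in> R \<and> adjacent ?H u w}" by simp
    from imageI[OF this, of ?\<phi>] show "flip a \<in> set (arcs x)"
      unfolding A by (simp add: a(1) flip_def)
  qed
  have cut: "card (cut (name ` U)) = card (boundary ?H U)" if "U \<subseteq> R" for U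
  proof -
    have mem: "name w \<in> name ` U \<longleftrightarrow> w \<in> U" if "w \<in> verts G" for w
      using inj_on_image_mem_iff[OF inj_name that, of U] \<open>U \<subseteq> R\<close> RV by blast
    have cut_eq: "cut (name ` U) = ?\<phi> ` {(u, w) \<in> {(u, w). u \<in> R \<and> adjacent ?H u w}.
        name u \<in> name ` U \<and> name w \<notin> name ` U}"
      unfolding cut_def A by force
    have "name u \<in> name ` U \<and> name w \<notin> name ` U \<longleftrightarrow> u \<in> U \<and> w \<notin> U" if "adjacent ?H u w" for u w
      using mem[OF adjV(1)[OF that]] mem[OF adjV(2)[OF that]] by simp
    then have "{(u, w) \<in> {(u, w). u \<in> R \<and> adjacent ?H u w}.
        name u \<in> name ` U \<and> name w \<notin> name ` U} = boundary ?H U"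
      unfolding boundary_def using that by blast
    with cut_eq have "cut (name ` U) = ?\<phi> ` boundary ?H U" by simp
    moreover have "inj_on ?\<phi> (boundary ?H U)"
      using inj adjV by (auto simp: inj_on_def boundary_def)
    ultimately show ?thesis by (simp add: card_image)
  qed
  have "decide x \<longleftrightarrow> (\<exists>U. name ` ?V0 \<subseteq> U \<and> U \<subseteq> name ` R \<and> card (cut U) \<le> B)"
    unfolding decide_def no_augmenting_path_iff_cut by (simp add: X v)
  also have "\<dots> \<longleftrightarrow> (\<exists>U. ?V0 \<subseteq> U \<and> U \<subseteq> R \<and> card (boundary ?H U) \<le> B)"
  proof
    assume "\<exists>U. name ` ?V0 \<subseteq> U \<and> U \<subseteq> name ` R \<and> card (cut U) \<le> B"
    then obtain U where U: "U \<subseteq> R" "name ` ?V0 \<subseteq> name ` U" "card (cut (name ` U)) \<le> B"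
      by (metis subset_image_iff)
    have "w \<in> U" if "w \<in> ?V0" for w
      using inj_on_image_mem_iff[OF inj_name, of w U] U(1,2) RV V(4) that by blast
    then have "?V0 \<subseteq> U" by blast
    then show "\<exists>U. ?V0 \<subseteq> U \<and> U \<subseteq> R \<and> card (boundary ?H U) \<le> B" using U cut by auto
  next
    assume "\<exists>U. ?V0 \<subseteq> U \<and> U \<subseteq> R \<and> card (boundary ?H U) \<le> B"
    then obtain U where "?V0 \<subseteq> U" "U \<subseteq> R" "card (boundary ?H U) \<le> B" by blast
    then show "\<exists>U. name ` ?V0 \<subseteq> U \<and> U \<subseteq> name ` R \<and> card (cut U) \<le> B"
      using cut by (intro exI[of _ "name ` U"]) auto
  qed
  also have "\<dots> \<longleftrightarrow> firebreak_yes (?H, ?V0, B)"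
  proof
    assume "\<exists>U. ?V0 \<subseteq> U \<and> U \<subseteq> R \<and> card (boundary ?H U) \<le> B"
    then obtain U where U: "?V0 \<subseteq> U" "U \<subseteq> R" "card (boundary ?H U) \<le> B" by blast
    have "finite R" unfolding R_def by (rule finite_reach[OF V(4)]) simp
    then show "firebreak_yes (?H, ?V0, B)"
      using U RV by (intro firebreak_if_cut[of _ U]) (auto intro: finite_subset)
  next
    assume yes: "firebreak_yes (?H, ?V0, B)"
    have "poly expansion_poly (B + \<Delta> * card ?V') \<le> poly expansion_poly ((\<Delta> + 1) * (B + card ?V'))"
      by (rule poly_nat_mono) (simp add: algebra_simps)
    then have "poly expansion_poly (B + \<Delta> * card ?V') * poly expansion_poly (B + \<Delta> * card ?V') \<le> N"
      unfolding N radius_def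
      by (simp add: poly_pcompose power2_eq_square mult_le_mono mult.commute)
    then show "\<exists>U. ?V0 \<subseteq> U \<and> U \<subseteq> R \<and> card (boundary ?H U) \<le> B"
      unfolding R_def using cut_if_firebreak[OF _ V(3) V(4) _ yes] by simp
  qed
  finally show ?thesis .
qed

theorem solvable: "poly_time_solvable (firebreak_class G \<Delta> name nb) firebreak_yes"
proof (rule poly_time_solvable_if_ptime[OF ptime_decide])
  fix x i assume "(x, i) \<in> firebreak_class G \<Delta> name nb"
  then obtain xs ys B where
    x: "x = list_data [com_data nb, list_data (map name xs), list_data (map name ys), nat_data B]"
    and V: "distinct xs" "distinct ys" "set xs \<subseteq> verts G" "set ys \<subseteq> verts G - set xs"
    and i: "i = (remove (set xs), set ys, B)"
    unfolding firebreak_class_def by auto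
  have "x \<in> instances" unfolding instances_def x using V by blast
  then show "x \<in> instances \<and> bool_data (decide x) = bool_data (firebreak_yes i)"
    using decide_correct[OF x V] i by simp
qed

end

theorem theorem1:
  fixes G :: "'v ugraph" and \<Delta> :: nat and name :: "'v \<Rightarrow> data" and nb :: com
  assumes "simple_graph G" and "infinite (verts G)" and "connected_graph G"
    and "has_max_degree G \<Delta>"
    and "finitely_represented G name nb"
    and "expansion_property G" and "polynomial_growth G"
  shows "poly_time_solvable (firebreak_class G \<Delta> name nb) firebreak_yes"
proof -
  obtain p :: "nat poly" where p: "\<And>v. v \<in> verts G \<Longrightarrow> \<exists>ws. set ws = neighbours G v \<and>
      computes_within nb (name v) (list_data (map name ws)) (poly p (dsize (name v)))"
    using assms(5) unfolding finitely_represented_def by blast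
  obtain ws where ws: "\<And>v. v \<in> verts G \<Longrightarrow> set (ws v) = neighbours G v"
    "\<And>v. v \<in> verts G \<Longrightarrow>
      computes_within nb (name v) (list_data (map name (ws v))) (poly p (dsize (name v)))"
    using p by metis
  obtain q :: "nat poly" where q: "\<And>u v. u \<in> verts G \<Longrightarrow> v \<in> verts G \<Longrightarrow>
      dsize (name v) \<le> poly q (dsize (name u) + graph_dist G u v)"
    using assms(5) unfolding finitely_represented_def by blast
  have inj: "inj_on name (verts G)" using assms(5) by (simp add: finitely_represented_def)
  \<comment> \<open>The lists \<open>ws\<close> depend on vertices, while \<open>ptime\<close> needs
    a function on data; \<open>inv_into\<close> recovers the vertex from its name.\<close>
  define nbs where "nbs d = list_data (map name (ws (inv_into (verts G) name d)))" for d
  have nbs: "nbs (name v) = list_data (map name (ws v))" if "v \<in> verts G" for v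
    using inj that by (simp add: nbs_def)
  obtain L :: "real poly" where L: "\<And>(k :: int) U. U \<subseteq> verts G \<Longrightarrow> finite U \<Longrightarrow>
      real (card U) > poly L (of_int k) \<Longrightarrow> int (card (escaping_edges G U)) \<ge> k + 1"
    using assms(6) unfolding expansion_property_def by blast
  obtain l :: "nat poly" where l: "\<And>k. poly L (real k) \<le> real (poly l k)"
    using real_poly_le_nat_poly by blast
  obtain P :: "real poly" where P: "\<And>v K. v \<in> verts G \<Longrightarrow>
      finite (graph_ball G v K) \<and> real (card (graph_ball G v K)) \<le> poly P (real K)"
    using assms(7) unfolding polynomial_growth_def by blast
  obtain g :: "nat poly" where g: "\<And>k. poly P (real k) \<le> real (poly g k)"
    using real_poly_le_nat_poly by blast
  interpret firebreak_graph G \<Delta> name nbs g q l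
  proof
    show "ptime (name ` verts G) nbs"
      by (rule ptime_of_computes_within[of _ nb _ p]) (use ws(2) nbs in auto)
    show "card (graph_ball G v K) \<le> poly g K" if "v \<in> verts G" for v K
      using P[OF that, of K] g[of K] by linarith
    \<comment> \<open>More than \<open>poly l k\<close> vertices exceed
      \<open>poly L (real k)\<close> as well and would force \<open>k + 1\<close> escaping
      edges.\<close>
    show "card U \<le> poly l k" if "U \<subseteq> verts G" "finite U" "card (escaping_edges G U) \<le> k" for U k
      using L[OF that(1,2), of "int k"] l[of k] that(3) by fastforce
  qed (use assms(1,4) ws(1) q inj P nbs in \<open>auto simp: has_max_degree_def\<close>)
  show ?thesis by (rule solvable)
qed

end
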